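(* Let $r\ge 3$ be an integer and let $G=(V,w)$ be an $\mathscr{F}_{2r}$-free coloured graph of order $n$ with $\delta(G)>\frac{14r-24}{7r-5}\,n$. Then there is a homomorphism from $G$ to $RK_r^-$. In other words, there is a partition $V=W_1\cup\ldots\cup W_r$ into pairwise disjoint (possibly empty) sets such that all edges within the partition classes are green and no edge from $W_1$ to $W_2$ is red.
   Context: A coloured graph is a pair $G=(V,w)$, where $V$ is a finite set and $w\colon V^2\to\{0,1,2\}$ is a symmetric function with $w(x,x)=0$ for all $x\in V$. Its order is $|V|$ (taken to be at least $1$ when the minimum degree is considered). For distinct $x,y\in V$ the edge $xy$ is called green, blue, or red according to whether $w(x,y)$ is $0$, $1$, or $2$. The degree of $x\in V$ is $d(x)=\sum_{y\in V}w(x,y)$ and the minimum degree is $\delta(G)=\min\{d(v)\colon v\in V\}$. A coloured graph $G'=(V',w')$ is a subgraph of $G=(V,w)$ if $V'\subseteq V$ and $w'(x,y)\le w(x,y)$ for all $x,y\in V'$. Coloured graphs $(V,w)$, $(V',w')$ are isomorphic if there is a bijection $\varphi\colon V\to V'$ with $w(x,y)=w'(\varphi(x),\varphi(y))$ for all $x,y\in V$. $G$ is $F$-free if it has no subgraph isomorphic to $F$, and $\mathscr{F}$-free (for a set $\mathscr{F}$ of coloured graphs) if it is $F$-free for every $F\in\mathscr{F}$. A homomorphism from $(V,w)$ to $(V',w')$ is a map $\varphi\colon V\to V'$ such that $w(x,y)\le w'(\varphi(x),\varphi(y))$ for any two distinct $x,y\in V$. For $m\ge 0$, $RK_m$ and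 $BK_m$ denote the coloured graphs on $m$ vertices all of whose edges are red, respectively blue. For $m\ge 2$, $RK_m^-$ is the coloured graph obtained from $RK_m$ by recolouring one of its edges blue. For integers $a\ge b\ge 1$, $G_{a+b,b}$ is the coloured graph of order $a$ consisting of an $RK_b$ and a vertex-disjoint $BK_{a-b}$, with all edges between the two being blue. For every positive integer $t$, $\mathscr{F}_t=\{G_{t,i}\colon i \text{ an integer},\ 1\le i\le \frac t2\}$. *)

theory Defs
  imports Complex_Main "HOL-Library.Disjoint_Sets"
begin

(* The weight is a total function on the carrier type; only its values on pairs of
   vertices matter, and all notions below look at nothing else. *)
type_synonym 'a cgraph = "'a set \<times> ('a \<Rightarrow> 'a \<Rightarrow> nat)"

abbreviation verts :: "'a cgraph \<Rightarrow> 'a set" where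
  "verts G \<equiv> fst G"

abbreviation weight :: "'a cgraph \<Rightarrow> 'a \<Rightarrow> 'a \<Rightarrow> nat" where
  "weight G \<equiv> snd G"

definition coloured_graph :: "'a cgraph \<Rightarrow> bool" where
  "coloured_graph G \<longleftrightarrow>
     finite (verts G) \<and>
     (\<forall>x\<in>verts G. \<forall>y\<in>verts G. weight G x y \<in> {0, 1, 2}) \<and>
     (\<forall>x\<in>verts G. \<forall>y\<in>verts G. weight G x y = weight G y x) \<and>
     (\<forall>x\<in>verts G. weight G x x = 0)"

definition order :: "'a cgraph \<Rightarrow> nat" where
  "order G = card (verts G)"

definition green_edge :: "'a cgraph \<Rightarrow> 'a \<Rightarrow> 'a \<Rightarrow> bool" where
  "green_edge G x y \<longleftrightarrow> x \<in> verts G \<and> y \<in> verts G \<and> x \<noteq> y \<and> weight G x y = 0"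

definition red_edge :: "'a cgraph \<Rightarrow> 'a \<Rightarrow> 'a \<Rightarrow> bool" where
  "red_edge G x y \<longleftrightarrow> x \<in> verts G \<and> y \<in> verts G \<and> x \<noteq> y \<and> weight G x y = 2"

definition vdegree :: "'a cgraph \<Rightarrow> 'a \<Rightarrow> nat" where
  "vdegree G x = (\<Sum>y\<in>verts G. weight G x y)"

(* unspecified for the graph without vertices *)
definition min_degree :: "'a cgraph \<Rightarrow> nat" where
  "min_degree G = Min (vdegree G ` verts G)"

definition subgraph :: "'a cgraph \<Rightarrow> 'a cgraph \<Rightarrow> bool" where
  "subgraph G' G \<longleftrightarrow>
     coloured_graph G' \<and> coloured_graph G \<and> verts G' \<subseteq> verts G \<and>
     (\<forall>x\<in>verts G'. \<forall>y\<in>verts G'. weight G' x y \<le> weight G x y)"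

definition isomorphic :: "'a cgraph \<Rightarrow> 'b cgraph \<Rightarrow> bool" where
  "isomorphic G H \<longleftrightarrow>
     (\<exists>\<phi>. bij_betw \<phi> (verts G) (verts H) \<and>
          (\<forall>x\<in>verts G. \<forall>y\<in>verts G. weight G x y = weight H (\<phi> x) (\<phi> y)))"

definition graph_free :: "'b cgraph \<Rightarrow> 'a cgraph \<Rightarrow> bool" where
  "graph_free F G \<longleftrightarrow> \<not> (\<exists>G'. subgraph G' G \<and> isomorphic G' F)"

definition family_free :: "'b cgraph set \<Rightarrow> 'a cgraph \<Rightarrow> bool" where
  "family_free \<F> G \<longleftrightarrow> (\<forall>F\<in>\<F>. graph_free F G)"

definition homomorphism :: "'a cgraph \<Rightarrow> 'b cgraph \<Rightarrow> ('a \<Rightarrow> 'b) \<Rightarrow> bool" where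
  "homomorphism G H \<phi> \<longleftrightarrow>
     \<phi> ` verts G \<subseteq> verts H \<and>
     (\<forall>x\<in>verts G. \<forall>y\<in>verts G. x \<noteq> y \<longrightarrow> weight G x y \<le> weight H (\<phi> x) (\<phi> y))"

definition RK :: "nat \<Rightarrow> nat cgraph" where
  "RK m = ({..<m}, \<lambda>x y. if x = y then 0 else 2)"

(* the blue edge is the one between 0 and 1; intended for m at least 2 *)
definition RK_minus :: "nat \<Rightarrow> nat cgraph" where
  "RK_minus m = (verts (RK m), \<lambda>x y. if {x, y} = {0, 1} then 1 else weight (RK m) x y)"

(* G_graph t b is the graph written G with index (a + b, b), where t = a + b: it has
   a = t - b vertices, of which {..<b} spans the red clique; intended for 1 <= b <= t - b *)
definition G_graph :: "nat \<Rightarrow> nat \<Rightarrow> nat cgraph" where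
  "G_graph t b =
     ({..<t - b}, \<lambda>x y. if x = y then 0 else if x < b \<and> y < b then 2 else 1)"

definition F_family :: "nat \<Rightarrow> nat cgraph set" where
  "F_family t = {G_graph t i | i. 1 \<le> i \<and> real i \<le> real t / 2}"

end

theory Submission
  imports Defs
begin

text \<open>
  Call x and y adjacent if the edge between them is not green, and give a pair the deficit
  2 - w x y. The degree condition says that for vertices with multiplicities of total C, some
  vertex has total deficit less than 14 C / (7 r - 5) towards them. Applied to a largest clique
  with as few blue edges as possible, this shows that the adjacency graph has no clique of size
  r + 1; together with the absence of red cliques of size r, this is all that is used of the
  forbidden family. Both conditions survive when weights are raised, so the weight may be taken
  maximal.

  Suppose then that y is green to x and to z while x and z are adjacent. By maximality x, y and
  y, z have cliques of size r - 1 as common neighbourhoods. Depending on how much these cliques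
  overlap, this yields a 5-wheel or a Moser spindle joined to a clique of hubs, or a sparser
  configuration, and suitable multiplicities contradict the degree condition in each case. Hence
  green is an equivalence relation with at most r classes. If there are r classes and every two
  of them span a red edge, a red clique can be extended class by class (exchanging vertices where
  necessary) to one of size r, which is impossible.
\<close>

subsection \<open>Weights with large minimum degree\<close>

text \<open>With multiplicities of total C, a contradiction arises once every vertex has deficit at
  least m and 14 C \<le> m (7 r - 5). A vertex counts as green to itself, so members of the
  configuration need no separate treatment. Give hubs multiplicity q and aim at m = 2 q: a vertex
  green to a hub then has enough deficit, and the budget left for the rim is 9 q / 7 with r - 2 hubs
  (wheel) and 16 q / 7 with r - 3 hubs (spindle). The obstacle is a vertex green to no hub. Green
  edges alone force deficit 6 on a wheel or spindle with unit multiplicities, short of the 2 q that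
  the budget demands. The rest must come from blue edges, which is why hubs are first made red, then
  the red edges between hubs and rim are maximised, and a non-red one among them is turned into a
  discount on one hub. Several of the resulting multiplicities use up the budget exactly. In the
  last part the same constants reappear as class sizes: the slacks of r classes sum to 14 r - 2 (7 r
  - 5) = 10 units.\<close>

lemma sum_pairs_insert:
  fixes f :: "'a \<Rightarrow> 'a \<Rightarrow> nat"
  assumes "finite L" "a \<notin> L" "\<And>x y. f x y = f y x" "\<And>x. f x x = 0"
  shows "(\<Sum>x\<in>insert a L. \<Sum>y\<in>insert a L. f x y) = (\<Sum>x\<in>L. \<Sum>y\<in>L. f x y) + 2 * (\<Sum>y\<in>L. f a y)"
proof -
  have "(\<Sum>x\<in>insert a L. \<Sum>y\<in>insert a L. f x y)
      = (\<Sum>y\<in>L. f a y) + (\<Sum>x\<in>L. f x a + (\<Sum>y\<in>L. f x y))"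
    using assms(1,2,4) by simp
  also have "\<dots> = (\<Sum>y\<in>L. f a y) + ((\<Sum>x\<in>L. f a x) + (\<Sum>x\<in>L. \<Sum>y\<in>L. f x y))"
    using assms(3)[of _ a] by (simp add: sum.distrib)
  finally show ?thesis by simp
qed

text \<open>For a maximal independent \<open>B\<close> among the vertices of degree at most 1, each
  degree-1 vertex outside \<open>B\<close> has its only neighbour in \<open>B\<close>, and these
  neighbours are distinct. So \<open>B\<close> contains all isolated vertices and at least half of
  those of degree 1. The additional half vertex, present when some degree is at least 2, decides the
  count in \<open>no_large_clique\<close>.\<close>

lemma independent_set_low_degree:
  fixes E :: "'a \<Rightarrow> 'a \<Rightarrow> bool"
  defines "dg K u \<equiv> card {x \<in> K. E u x}"
  assumes fin: "finite K" and symE: "\<And>x y. E x y = E y x" and irrE: "\<And>x. \<not> E x x"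
  shows "\<exists>B\<subseteq>K. (\<forall>x\<in>B. \<forall>y\<in>B. \<not> E x y) \<and>
    2 * card {u\<in>K. dg K u = 0} + card {u\<in>K. dg K u = 1}
      + (if \<exists>u\<in>K. 2 \<le> dg K u then 1 else 0) \<le> 2 * card B"
proof -
  define D0 D1 where "D0 = {u\<in>K. dg K u = 0}" and "D1 = {u\<in>K. dg K u = 1}"
  have finD: "finite D0" "finite D1" using fin unfolding D0_def D1_def by auto
  define S where "S = {B. B \<subseteq> D0 \<union> D1 \<and> (\<forall>x\<in>B. \<forall>y\<in>B. \<not> E x y)}"
  have "finite S" unfolding S_def using finD by simp
  moreover have "{} \<in> S" unfolding S_def by simp
  ultimately obtain B where B: "B \<in> S" and Bmax: "\<And>B'. B' \<in> S \<Longrightarrow> B \<subseteq> B' \<Longrightarrow> B' = B"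
    using finite_has_maximal2[of S "{}"] by metis
  have Bsub: "B \<subseteq> D0 \<union> D1" and Bind: "\<And>x y. x \<in> B \<Longrightarrow> y \<in> B \<Longrightarrow> \<not> E x y"
    using B unfolding S_def by auto
  have finB: "finite B" using Bsub finD finite_subset by blast
  have D0E: "\<not> E x y" if "x \<in> D0" "y \<in> K" for x y
    using that fin unfolding D0_def dg_def by auto
  have outB: "\<exists>y\<in>B. E u y" if "u \<in> D0 \<union> D1" "u \<notin> B" for u
  proof (rule ccontr)
    assume "\<not> (\<exists>y\<in>B. E u y)"
    then have "insert u B \<in> S" using that Bsub Bind symE irrE unfolding S_def by auto
    then show False using Bmax[of "insert u B"] that by blast
  qed
  have DK: "D0 \<subseteq> K" "D1 \<subseteq> K" unfolding D0_def D1_def by auto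
  have D0B: "D0 \<subseteq> B"
    using outB D0E Bsub DK by blast
  have uniq: "x = y" if "u \<in> D1" "E u x" "E u y" "x \<in> K" "y \<in> K" for u x y
  proof -
    have "card {x\<in>K. E u x} = 1" using that(1) unfolding D1_def dg_def by auto
    then obtain z where "{x\<in>K. E u x} = {z}" using card_1_singletonE by metis
    moreover have "x \<in> {x\<in>K. E u x}" "y \<in> {x\<in>K. E u x}" using that by auto
    ultimately show ?thesis by simp
  qed
  define p where "p u = (SOME y. y \<in> B \<and> E u y)" for u
  have p: "p u \<in> B" "E u (p u)" if "u \<in> D1 - B" for u
    using someI_ex[of "\<lambda>y. y \<in> B \<and> E u y"] outB[of u] that unfolding p_def by auto
  have pD: "p u \<in> D1 \<inter> B" if "u \<in> D1 - B" for u
    using p[OF that] Bsub D0E[of "p u" u] symE that DK by blast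
  have inj: "inj_on p (D1 - B)"
  proof
    fix u v assume uv: "u \<in> D1 - B" "v \<in> D1 - B" "p u = p v"
    then have "E (p u) u" "E (p u) v" using p symE by metis+
    then show "u = v" using uniq[of "p u" u v] pD[OF uv(1)] uv DK by blast
  qed
  have im: "p ` (D1 - B) \<subseteq> D1 \<inter> B" using pD by blast
  have le: "card (D1 - B) \<le> card (D1 \<inter> B)"
    using card_inj_on_le[OF inj im] finD by blast
  have cD1: "card D1 = card (D1 - B) + card (D1 \<inter> B)"
    using card_Diff_subset_Int[of D1 B] finD card_mono[of D1 "D1 \<inter> B"] by (simp add: Int_commute)
  have disj: "D0 \<inter> D1 = {}" unfolding D0_def D1_def by auto
  have "B = D0 \<union> (D1 \<inter> B)" using D0B Bsub by blast
  then have cB: "card B = card D0 + card (D1 \<inter> B)"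
    using card_Un_disjoint[of D0 "D1 \<inter> B"] finD disj by (metis Int_assoc Int_empty_left finite_Int)
  show ?thesis
  proof (cases "\<exists>u\<in>K. 2 \<le> dg K u")
    case False
    then show ?thesis using cB le cD1 Bind Bsub DK unfolding D0_def D1_def
      by (intro exI[of _ B]) auto
  next
    case True
    then obtain q where q: "q \<in> K" "2 \<le> dg K q" by blast
    show ?thesis
    \<comment> \<open>A degree-1 vertex with its neighbour outside \<open>D1\<close> lies in
      \<open>B\<close> but is no value of \<open>p\<close>, which makes the inequality strict.
      Without such a vertex, \<open>q\<close> has no neighbour in \<open>B\<close> and can be
      added.\<close>
    proof (cases "\<exists>u\<in>D1. \<exists>y\<in>K. E u y \<and> y \<notin> D1")
      case True
      then obtain u y where u: "u \<in> D1" "y \<in> K" "E u y" "y \<notin> D1" by blast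
      have nb: "y \<notin> B" using u D0E[of y u] Bsub symE DK by blast
      have uB: "u \<in> B" using outB[of u] u nb uniq[of u y] Bsub DK by blast
      have "u \<notin> p ` (D1 - B)"
      proof
        assume "u \<in> p ` (D1 - B)"
        then obtain v where v: "v \<in> D1 - B" "u = p v" by blast
        then have "E u v" using p symE by metis
        then show False using uniq[of u v y] u v DK by blast
      qed
      then have "p ` (D1 - B) \<subset> D1 \<inter> B" using im u uB by blast
      then have "card (D1 - B) < card (D1 \<inter> B)"
        using psubset_card_mono[of "D1 \<inter> B" "p ` (D1 - B)"] finD card_image[OF inj] by simp
      then show ?thesis using cB cD1 Bind Bsub DK q unfolding D0_def D1_def
        by (intro exI[of _ B]) auto
    next
      case False
      have qn: "q \<notin> D0" "q \<notin> D1" using q unfolding D0_def D1_def by auto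
      have "\<not> E q x" if "x \<in> B" for x
        using that False D0E[of x q] Bsub symE q qn by blast
      then have "\<forall>x\<in>insert q B. \<forall>y\<in>insert q B. \<not> E x y" using Bind irrE symE by blast
      moreover have "q \<notin> B" using qn Bsub by blast
      then have "card (insert q B) = card B + 1" using finB by simp
      moreover have "insert q B \<subseteq> K" using q Bsub DK by blast
      ultimately show ?thesis using cB le cD1 unfolding D0_def D1_def
        by (intro exI[of _ "insert q B"]) auto
    qed
  qed
qed

text \<open>\<open>w\<close> vanishes off \<open>V\<close> and on the diagonal, so it can be used
  without membership side conditions. \<open>deg\<close> is the minimum degree hypothesis cleared of
  its denominator: the deficit of \<open>v\<close>, including 2 towards itself, is twice the order
  minus the degree, and 2 - (14 r - 24) / (7 r - 5) = 14 / (7 r - 5).\<close>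

locale weighted =
  fixes V :: "'a set" and w :: "'a \<Rightarrow> 'a \<Rightarrow> nat" and r :: nat
  assumes fin: "finite V"
    and sym: "w x y = w y x"
    and irr [simp]: "w x x = 0"
    and le2: "w x y \<le> 2"
    and supp: "w x y \<noteq> 0 \<Longrightarrow> x \<in> V"
    and r3: "3 \<le> r"
    and deg: "v \<in> V \<Longrightarrow> (7 * int r - 5) * int (\<Sum>u\<in>V. 2 - w v u) < 14 * int (card V)"
begin

text \<open>
  The strict integer inequality a < b is written a <= b - 1, so that it can be added up over
  families that may be empty.
\<close>
definition light :: "('a \<Rightarrow> nat) \<Rightarrow> nat \<Rightarrow> bool" where
  "light F C \<longleftrightarrow> (7 * int r - 5) * int (\<Sum>v\<in>V. F v) \<le> (14 * int (card V) - 1) * int C"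

definition clique :: "'a set \<Rightarrow> bool" where
  "clique K \<longleftrightarrow> K \<subseteq> V \<and> (\<forall>x\<in>K. \<forall>y\<in>K. x \<noteq> y \<longrightarrow> w x y \<noteq> 0)"

definition red_clique :: "'a set \<Rightarrow> bool" where
  "red_clique K \<longleftrightarrow> K \<subseteq> V \<and> (\<forall>x\<in>K. \<forall>y\<in>K. x \<noteq> y \<longrightarrow> w x y = 2)"

lemma clique_finite: "clique K \<Longrightarrow> finite K"
  unfolding clique_def using fin finite_subset by blast

lemma clique_insert:
  "v \<in> V \<Longrightarrow> clique K \<Longrightarrow> (\<And>u. u \<in> K \<Longrightarrow> w v u \<noteq> 0) \<Longrightarrow> clique (insert v K)"
  unfolding clique_def using sym by (metis insertE insert_subset)

lemma red_clique_insert: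
  "v \<in> V \<Longrightarrow> red_clique K \<Longrightarrow> (\<And>u. u \<in> K \<Longrightarrow> w v u = 2) \<Longrightarrow> red_clique (insert v K)"
  unfolding red_clique_def using sym by (metis insertE insert_subset)

lemma clique_mono: "clique K \<Longrightarrow> K' \<subseteq> K \<Longrightarrow> clique K'"
  unfolding clique_def by blast

lemma red_clique_mono: "red_clique K \<Longrightarrow> K' \<subseteq> K \<Longrightarrow> red_clique K'"
  unfolding red_clique_def by blast

lemma red_clique_clique: "red_clique K \<Longrightarrow> clique K"
  unfolding red_clique_def clique_def by auto

lemma light_deficit: "u \<in> V \<Longrightarrow> light (\<lambda>v. 2 - w u v) 1"
  using deg[of u] unfolding light_def by simp

lemma light_add: "light F C \<Longrightarrow> light F' C' \<Longrightarrow> light (\<lambda>v. F v + F' v) (C + C')"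
  unfolding light_def by (simp add: sum.distrib algebra_simps)

lemma light_0: "light (\<lambda>_. 0) 0"
  unfolding light_def by simp

lemma light_scale: "light F C \<Longrightarrow> light (\<lambda>v. k * F v) (k * C)"
  unfolding light_def
  using mult_left_mono[of "(7 * int r - 5) * int (\<Sum>v\<in>V. F v)" "(14 * int (card V) - 1) * int C" "int k"]
  by (simp add: sum_distrib_left[symmetric] algebra_simps)

lemma light_sum:
  assumes "finite L" "\<And>u. u \<in> L \<Longrightarrow> f u \<in> V"
  shows "light (\<lambda>v. \<Sum>u\<in>L. c u * (2 - w (f u) v)) (\<Sum>u\<in>L. c u)"
  using assms
proof (induction L)
  case empty
  then show ?case using light_0 by simp
next
  case (insert x L)
  have "light (\<lambda>v. c x * (2 - w (f x) v)) (c x * 1)"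
    using light_scale light_deficit insert by blast
  then show ?case using light_add[of "\<lambda>v. c x * (2 - w (f x) v)" "c x"] insert by simp
qed

text \<open>Summation over all vertices: the average of \<open>F\<close> is below 14 C / (7 r - 5),
  hence below \<open>m\<close>. The last hypothesis is 14 C \<le> m (7 r - 5) written without
  subtraction, and \<open>0 < C\<close> restores the strictness that \<open>light\<close> encodes as
  a unit per multiplicity.\<close>

lemma light_contra:
  assumes "light F C" "0 < C" "\<And>v. v \<in> V \<Longrightarrow> m \<le> F v" "14 * C + 5 * m \<le> 7 * m * r"
  shows False
proof -
  have "int (14 * C + 5 * m) \<le> int (7 * m * r)" using assms(4) by (simp only: of_nat_le_iff)
  then have C: "14 * int C \<le> int m * (7 * int r - 5)" by (simp add: algebra_simps)
  have "of_nat (card V) * m \<le> (\<Sum>v\<in>V. F v)"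
    using assms(3) by (intro sum_bounded_below) auto
  then have "int (card V) * int m \<le> int (\<Sum>v\<in>V. F v)"
    by (metis of_nat_id of_nat_le_iff of_nat_mult)
  then have "(7 * int r - 5) * (int (card V) * int m) \<le> (7 * int r - 5) * int (\<Sum>v\<in>V. F v)"
    using r3 by (intro mult_left_mono) auto
  also have "\<dots> \<le> (14 * int (card V) - 1) * int C" using assms(1) unfolding light_def .
  also have "\<dots> = int (card V) * (14 * int C) - int C" by (simp add: algebra_simps)
  also have "\<dots> \<le> int (card V) * (int m * (7 * int r - 5)) - int C"
    using C by (simp add: mult_left_mono)
  finally show False using assms(2) by (simp add: algebra_simps)
qed

text \<open>A maximum clique \<open>K\<close> of size a > r has only red subcliques \<open>B\<close>
  with a + |B| \<le> 2 r - 1. Multiplicities decrease with the number of blue edges at a vertex, so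
  their total is controlled by a + |B| through \<open>independent_set_low_degree\<close>. Minimality
  of the blue edges of \<open>K\<close> compensates for a low multiplicity: a vertex green only to
  \<open>u\<close> inherits at least as many blue edges as \<open>u\<close> has.\<close>

lemma no_large_clique:
  assumes free: "\<And>K B. clique K \<Longrightarrow> B \<subseteq> K \<Longrightarrow> B \<noteq> {} \<Longrightarrow> red_clique B \<Longrightarrow> card K + card B < 2 * r"
    and K1: "clique K1"
  shows "card K1 \<le> r"
proof (rule ccontr)
  assume big: "\<not> card K1 \<le> r"
  define bl where "bl x y = (if w x y = 1 then 1 else 0 :: nat)" for x y
  have blsym: "bl x y = bl y x" and blirr: "bl x x = 0" for x y
    unfolding bl_def by (simp_all add: sym)
  define a where "a = Max (card ` {K. clique K})"
  have finC: "finite {K. clique K}"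
    by (rule finite_subset[of _ "Pow V"]) (auto simp: clique_def fin)
  have amax: "card K \<le> a" if "clique K" for K
    unfolding a_def using finC that by (intro Max_ge) auto
  have "a \<in> card ` {K. clique K}"
    unfolding a_def using finC K1 by (intro Max_in) auto
  then obtain K2 where K2: "clique K2 \<and> card K2 = a" by auto
  define K where "K = arg_min (\<lambda>K. \<Sum>x\<in>K. \<Sum>y\<in>K. bl x y) (\<lambda>K. clique K \<and> card K = a)"
  have K: "clique K" "card K = a"
    using arg_min_natI[of "\<lambda>K. clique K \<and> card K = a", OF K2] unfolding K_def by auto
  have Kmin: "(\<Sum>x\<in>K. \<Sum>y\<in>K. bl x y) \<le> (\<Sum>x\<in>K'. \<Sum>y\<in>K'. bl x y)" if "clique K'" "card K' = a" for K'
    unfolding K_def by (rule arg_min_nat_le) (simp add: that)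
  have ar: "r < a" using amax[OF K1] big by simp
  have finK: "finite K" using K clique_finite by blast
  have KV: "K \<subseteq> V" using K unfolding clique_def by blast
  define dg where "dg u = card {x\<in>K. w u x = 1}" for u
  define D0 D1 D2 where "D0 = {u\<in>K. dg u = 0}" and "D1 = {u\<in>K. dg u = 1}" and "D2 = {u\<in>K. 2 \<le> dg u}"
  have Dp: "K = D0 \<union> D1 \<union> D2" "D0 \<inter> D1 = {}" "(D0 \<union> D1) \<inter> D2 = {}"
    unfolding D0_def D1_def D2_def by auto
  have finD: "finite D0" "finite D1" "finite D2" using finK Dp(1) by auto
  have cK: "a = card D0 + card D1 + card D2"
    using Dp finD K by (metis card_Un_disjoint finite_UnI)
  have sumK: "(\<Sum>u\<in>K. f u) = (\<Sum>u\<in>D0. f u) + (\<Sum>u\<in>D1. f u) + (\<Sum>u\<in>D2. f u)" for f :: "'a \<Rightarrow> nat"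
    using Dp finD by (metis sum.union_disjoint finite_UnI)
  have "\<exists>B\<subseteq>K. (\<forall>x\<in>B. \<forall>y\<in>B. \<not> w x y = 1) \<and>
      2 * card D0 + card D1 + (if \<exists>u\<in>K. 2 \<le> dg u then 1 else 0) \<le> 2 * card B"
    unfolding D0_def D1_def dg_def
    by (rule independent_set_low_degree[of K "\<lambda>x y. w x y = 1"]) (simp_all add: finK sym)
  moreover have D2ne: "(\<exists>u\<in>K. 2 \<le> dg u) = (D2 \<noteq> {})" unfolding D2_def by blast
  ultimately obtain B where B: "B \<subseteq> K" "\<forall>x\<in>B. \<forall>y\<in>B. w x y \<noteq> 1"
    and cB: "2 * card D0 + card D1 + (if D2 \<noteq> {} then 1 else 0) \<le> 2 * card B"
    unfolding D2ne by blast
  have rB: "red_clique B" unfolding red_clique_def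
  proof (intro conjI ballI impI)
    show "B \<subseteq> V" using B KV by blast
    fix x y assume "x \<in> B" "y \<in> B" "x \<noteq> y"
    then have "w x y \<noteq> 0" "w x y \<noteq> 1" using B K unfolding clique_def by blast+
    then show "w x y = 2" using le2[of x y] by simp
  qed
  have cK0: "0 < card D0 + card D1 + card D2" using ar cK by linarith
  then have "B \<noteq> {}" using cB by (cases "D2 = {}") auto
  then have ab: "a + card B < 2 * r" using free[OF K(1) B(1) _ rB] K by simp
  have green: "\<exists>u\<in>K. w u v = 0" if "v \<in> V" for v
  proof (rule ccontr)
    assume "\<not> (\<exists>u\<in>K. w u v = 0)"
    then have n: "\<And>u. u \<in> K \<Longrightarrow> w v u \<noteq> 0" using sym by metis
    then have "clique (insert v K)" using clique_insert that K by blast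
    moreover have "v \<notin> K" using n irr by blast
    ultimately show False using amax[of "insert v K"] K finK by simp
  qed
  \<comment> \<open>Exchanging \<open>u\<close> for \<open>v\<close> gives another maximum clique,
    so \<open>v\<close> sends at least \<open>dg u\<close> blue edges to the rest of
    \<open>K\<close>.\<close>
  have one: "2 * c u + k * dg u \<le> (\<Sum>x\<in>K. c x * (2 - w x v))"
    if v: "v \<in> V" and u: "u \<in> K" "w u v = 0" and only: "\<And>x. x \<in> K \<Longrightarrow> w x v = 0 \<Longrightarrow> x = u"
      and ck: "\<And>x. x \<in> K \<Longrightarrow> k \<le> c x" for u v k and c :: "'a \<Rightarrow> nat"
  proof -
    define K0 where "K0 = K - {u}"
    have K0: "K = insert u K0" "u \<notin> K0" "finite K0" "clique K0"
      using u finK clique_mono[OF K(1)] unfolding K0_def by auto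
    have nv: "w v x \<noteq> 0" if "x \<in> K0" for x
      using only[of x] that sym[of v x] unfolding K0_def by auto
    have vK0: "v \<notin> K0" using nv irr by blast
    have "clique (insert v K0)" using clique_insert v K0 nv by blast
    moreover have "card (insert v K0) = a" using K K0 vK0 by simp
    ultimately have "(\<Sum>x\<in>insert u K0. \<Sum>y\<in>insert u K0. bl x y) \<le> (\<Sum>x\<in>insert v K0. \<Sum>y\<in>insert v K0. bl x y)"
      using Kmin K0 by metis
    then have le: "(\<Sum>y\<in>K0. bl u y) \<le> (\<Sum>y\<in>K0. bl v y)"
      using sum_pairs_insert[of K0 u bl, OF K0(3,2) blsym blirr]
        sum_pairs_insert[of K0 v bl, OF K0(3) vK0 blsym blirr] by linarith
    have "dg u = (\<Sum>y\<in>K. bl u y)"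
      unfolding dg_def bl_def using finK by (simp add: sum.If_cases Int_def)
    also have "\<dots> = (\<Sum>y\<in>K0. bl u y)" using K0 blirr by simp
    finally have "k * dg u \<le> k * (\<Sum>y\<in>K0. bl v y)" using le by simp
    also have "\<dots> = (\<Sum>y\<in>K0. k * bl v y)" by (simp add: sum_distrib_left)
    also have "\<dots> \<le> (\<Sum>x\<in>K0. c x * (2 - w x v))"
    proof (intro sum_mono mult_mono)
      fix x assume x: "x \<in> K0"
      then show "k \<le> c x" using ck K0 by blast
      show "bl v x \<le> 2 - w x v" unfolding bl_def sym[of v x] by simp
    qed auto
    finally show ?thesis using K0 u by simp
  qed
  have two: "2 * c u + 2 * c x \<le> (\<Sum>x\<in>K. c x * (2 - w x v))"
    if "u \<in> K" "x \<in> K" "w u v = 0" "w x v = 0" "x \<noteq> u" for u x v and c :: "'a \<Rightarrow> nat"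
  proof -
    have "(\<Sum>x\<in>{u,x}. c x * (2 - w x v)) \<le> (\<Sum>x\<in>K. c x * (2 - w x v))"
      using that finK by (intro sum_mono2) auto
    then show ?thesis using that by simp
  qed
  show False
  proof (cases "D2 = {}")
    case True
    \<comment> \<open>The deficit 6 arises as 2 * 3, as 2 * 2 + 2 * 1, or from two green vertices.
      The total 3 |D0| + 2 |D1| is at most a + 2 |B| \<le> 3 r - 3, because a + |B| \<le> 2 r - 1
      and |B| \<le> r - 2.\<close>
    define c where "c u = (if dg u = 0 then 3 else 2 :: nat)" for u
    have "(\<Sum>u\<in>K. c u) = 3 * card D0 + 2 * card D1"
      unfolding sumK using True by (simp add: c_def D0_def D1_def)
    moreover have "3 * card D0 + 2 * card D1 + 3 \<le> 3 * r" using ab ar cK cB True by simp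
    ultimately have C: "(\<Sum>u\<in>K. c u) + 3 \<le> 3 * r" "0 < (\<Sum>u\<in>K. c u)" using cK0 True by auto
    have b: "14 * (\<Sum>u\<in>K. c u) + 5 * 6 \<le> 7 * 6 * r" using C by linarith
    show False
    proof (rule light_contra[OF light_sum[of K "\<lambda>u. u" c] C(2), of 6])
      fix v assume v: "v \<in> V"
      obtain u where u: "u \<in> K" "w u v = 0" using green[OF v] by blast
      show "6 \<le> (\<Sum>u\<in>K. c u * (2 - w u v))"
      proof (cases "\<exists>x\<in>K. w x v = 0 \<and> x \<noteq> u")
        case True
        then obtain x where "x \<in> K" "w x v = 0" "x \<noteq> u" by blast
        then show ?thesis using two[of u x v c] u unfolding c_def by (auto split: if_splits)
      next
        case False
        then have only: "\<And>x. x \<in> K \<Longrightarrow> w x v = 0 \<Longrightarrow> x = u" by blast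
        have "6 \<le> 2 * c u + 2 * dg u" unfolding c_def by auto
        also have "\<dots> \<le> (\<Sum>x\<in>K. c x * (2 - w x v))"
          by (rule one[OF v u only]) (auto simp: c_def)
        finally show ?thesis .
      qed
    qed (use finK KV b in blast)+
  next
    case False
    \<comment> \<open>Now 8 = 2 * 4 = 2 * 3 + 2 * 1 = 2 * 2 + 2 * 2. The total is 2 a + 2 |D0| +
      |D1| \<le> 2 a + 2 |B| - 1 \<le> 4 r - 3, where the -1 is due to \<open>D2\<close> being
      nonempty; a total of 4 r - 2 would be too large.\<close>
    define c where "c u = (if dg u = 0 then 4 else if dg u = 1 then 3 else 2 :: nat)" for u
    have "(\<Sum>u\<in>K. c u) = 4 * card D0 + 3 * card D1 + 2 * card D2"
      unfolding sumK by (simp add: c_def D0_def D1_def D2_def)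
    moreover have "4 * card D0 + 3 * card D1 + 2 * card D2 + 3 \<le> 4 * r" using ab cK cB False by simp
    ultimately have C: "(\<Sum>u\<in>K. c u) + 3 \<le> 4 * r" "0 < (\<Sum>u\<in>K. c u)" using cK0 by auto
    have b: "14 * (\<Sum>u\<in>K. c u) + 5 * 8 \<le> 7 * 8 * r" using C by linarith
    show False
    proof (rule light_contra[OF light_sum[of K "\<lambda>u. u" c] C(2), of 8])
      fix v assume v: "v \<in> V"
      obtain u where u: "u \<in> K" "w u v = 0" using green[OF v] by blast
      show "8 \<le> (\<Sum>u\<in>K. c u * (2 - w u v))"
      proof (cases "\<exists>x\<in>K. w x v = 0 \<and> x \<noteq> u")
        case True
        then obtain x where "x \<in> K" "w x v = 0" "x \<noteq> u" by blast
        then show ?thesis using two[of u x v c] u unfolding c_def by (auto split: if_splits)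
      next
        case False
        then have only: "\<And>x. x \<in> K \<Longrightarrow> w x v = 0 \<Longrightarrow> x = u" by blast
        have "8 \<le> 2 * c u + 2 * dg u" unfolding c_def by auto
        also have "\<dots> \<le> (\<Sum>x\<in>K. c x * (2 - w x v))"
          by (rule one[OF v u only]) (auto simp: c_def)
        finally show ?thesis .
      qed
    qed (use finK KV b in blast)+
  qed
qed

end

subsection \<open>Cliques of hubs\<close>

lemma member_le_sum2:
  fixes f :: "'a \<Rightarrow> nat"
  assumes "finite L" "x \<in> L" "y \<in> L" "x \<noteq> y"
  shows "f x + f y \<le> sum f L"
proof -
  have "sum f {x, y} \<le> sum f L" using assms by (intro sum_mono2) auto
  then show ?thesis using assms by simp
qed

locale weighted_free = weighted +
  assumes clique_le: "clique K \<Longrightarrow> card K \<le> r"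
    and red_clique_less: "red_clique K \<Longrightarrow> card K < r"
begin

lemma triangle_card:
  assumes L: "clique L" "\<And>l. l \<in> L \<Longrightarrow> w a l \<noteq> 0" "\<And>l. l \<in> L \<Longrightarrow> w b l \<noteq> 0" "\<And>l. l \<in> L \<Longrightarrow> w c l \<noteq> 0"
    and abc: "w a b \<noteq> 0" "w a c \<noteq> 0" "w b c \<noteq> 0"
  shows "card L + 3 \<le> r"
proof -
  have V: "a \<in> V" "b \<in> V" "c \<in> V" using supp[OF abc(1)] supp[OF abc(3)] supp[of c a] abc sym by auto
  have n: "c \<notin> L" "b \<notin> insert c L" "a \<notin> insert b (insert c L)" using L(2)[of a] L(3)[of b] L(4)[of c] abc by auto
  have "clique (insert a (insert b (insert c L)))"
    using L abc V by (intro clique_insert) auto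
  from clique_le[OF this] show ?thesis using n clique_finite[OF L(1)] by simp
qed

lemma red_edge_card:
  assumes L: "red_clique L" "\<And>l. l \<in> L \<Longrightarrow> w a l = 2" "\<And>l. l \<in> L \<Longrightarrow> w b l = 2"
    and ab: "w a b = 2"
  shows "card L + 2 < r"
proof -
  have V: "a \<in> V" "b \<in> V" using supp[of a b] supp[of b a] ab sym[of a b] by auto
  have n: "b \<notin> L" "a \<notin> insert b L" using L ab irr by fastforce+
  have "red_clique (insert a (insert b L))"
    using L ab V by (intro red_clique_insert) auto
  from red_clique_less[OF this] show ?thesis
    using n clique_finite[OF red_clique_clique[OF L(1)]] by simp
qed

lemma red_triangle_card:
  assumes L: "red_clique L" "\<And>l. l \<in> L \<Longrightarrow> w a l = 2" "\<And>l. l \<in> L \<Longrightarrow> w b l = 2" "\<And>l. l \<in> L \<Longrightarrow> w c l = 2"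
    and abc: "w a b = 2" "w a c = 2" "w b c = 2"
  shows "card L + 3 < r"
proof -
  have V: "a \<in> V" "b \<in> V" "c \<in> V" using supp[of a b] supp[of b c] supp[of c a] abc sym[of a c] by auto
  have n: "c \<notin> L" "b \<notin> insert c L" "a \<notin> insert b (insert c L)" using L abc irr by fastforce+
  have "red_clique (insert a (insert b (insert c L)))"
    using L abc V by (intro red_clique_insert) auto
  from red_clique_less[OF this] show ?thesis
    using n clique_finite[OF red_clique_clique[OF L(1)]] by simp
qed

text \<open>A clique \<open>L\<close> of hubs, completely joined to the \<open>k\<close> vertices
  \<open>u 0\<close>, ..., \<open>u (k - 1)\<close>. The shape of the rim is kept apart as a
  predicate on \<open>u\<close>, so that exchange arguments on hubs serve wheels and spindles
  alike.\<close>

definition hub :: "nat \<Rightarrow> nat \<Rightarrow> 'a set \<Rightarrow> (nat \<Rightarrow> 'a) \<Rightarrow> bool" where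
  "hub h k L u \<longleftrightarrow> clique L \<and> card L = h \<and> (\<forall>i<k. u i \<in> V \<and> (\<forall>l\<in>L. w (u i) l \<noteq> 0))"

lemma hub_exchange:
  assumes hub: "hub h k L u" and v: "v \<in> V" "l \<in> L"
    and vL: "\<And>x. x \<in> L - {l} \<Longrightarrow> w v x \<noteq> 0" and vu: "\<And>i. i < k \<Longrightarrow> w v (u i) \<noteq> 0"
  shows "hub h k (insert v (L - {l})) u" "v \<notin> L - {l}"
proof -
  have L: "clique L" "card L = h" "finite L" using hub clique_finite unfolding hub_def by auto
  show n: "v \<notin> L - {l}" using vL[of v] by auto
  have "clique (insert v (L - {l}))"
    using clique_insert[OF v(1) clique_mono[OF L(1)]] vL by blast
  moreover have "card (insert v (L - {l})) = h" using n L v by (metis card.insert card.remove finite_Diff)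
  moreover have "w (u i) v \<noteq> 0" if "i < k" for i using vu[OF that] sym[of v] by simp
  ultimately show "hub h k (insert v (L - {l})) u" using hub unfolding hub_def by auto
qed

text \<open>Take a configuration with the most red edges inside \<open>L\<close>. If
  \<open>l1\<close>, \<open>l2\<close> are not joined in red, both may drop to multiplicity 2,
  against 3 for other hubs and 1 on the rim. A vertex of deficit below 6 is then green to
  \<open>l1\<close> or \<open>l2\<close>, red to all other hubs and green to no rim vertex, so it
  could replace that hub and increase the number of red edges.\<close>

lemma hub_red_exists:
  assumes misses: "\<And>L u v. hub h k L u \<Longrightarrow> Q u \<Longrightarrow> v \<in> V \<Longrightarrow> (\<And>l. l \<in> L \<Longrightarrow> w l v \<noteq> 0)
      \<Longrightarrow> 6 \<le> (\<Sum>i<k. 2 - w (u i) v)"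
    and count: "14 * (3 * h + k) + 2 \<le> 42 * r"
    and ex: "hub h k L0 u0" "Q u0"
  shows "\<exists>L u. hub h k L u \<and> Q u \<and> red_clique L"
proof -
  define \<rho> where "\<rho> x y = (if w x y = 2 then 1 else 0 :: nat)" for x y
  have \<rho>sym: "\<rho> x y = \<rho> y x" and \<rho>irr: "\<rho> x x = 0" for x y
    unfolding \<rho>_def by (simp_all add: sym)
  define P where "P Lu = (hub h k (fst Lu) (snd Lu) \<and> Q (snd Lu))" for Lu
  define f where "f Lu = (\<Sum>x\<in>fst Lu. \<Sum>y\<in>fst Lu. \<rho> x y)" for Lu :: "'a set \<times> (nat \<Rightarrow> 'a)"
  have "f Lu < h * h + 1" if "P Lu" for Lu
  proof -
    have c: "card (fst Lu) = h" using that unfolding P_def hub_def by auto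
    have "f Lu \<le> (\<Sum>x\<in>fst Lu. \<Sum>y\<in>fst Lu. 1)"
      unfolding f_def \<rho>_def by (intro sum_mono) auto
    then show ?thesis using c by simp
  qed
  moreover have "P (L0, u0)" using ex unfolding P_def by simp
  ultimately obtain Lu where Lu: "P Lu" and max: "\<And>Lu'. P Lu' \<Longrightarrow> f Lu' \<le> f Lu"
    using Lattices_Big.ex_has_greatest_nat[of P "(L0, u0)" f "h * h + 1"] by blast
  obtain L u where LuE: "Lu = (L, u)" by force
  have hub: "hub h k L u" and Q: "Q u" using Lu LuE unfolding P_def by auto
  have L: "clique L" "card L = h" "finite L" "L \<subseteq> V"
    using hub clique_finite unfolding hub_def clique_def by auto
  have uV: "u i \<in> V" if "i < k" for i using hub that unfolding hub_def by blast
  have "red_clique L"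
  proof (rule ccontr)
    assume "\<not> red_clique L"
    then obtain l1 l2 where l12: "l1 \<in> L" "l2 \<in> L" "l1 \<noteq> l2" "w l1 l2 \<noteq> 2"
      using L(4) unfolding red_clique_def by blast
    define c where "c l = (if l = l1 \<or> l = l2 then 2 else 3 :: nat)" for l
    define F where "F v = (\<Sum>l\<in>L. c l * (2 - w l v)) + (\<Sum>i<k. 1 * (2 - w (u i) v))" for v
    have lF: "light F (sum c L + (\<Sum>i<k. 1))"
      unfolding F_def using L uV by (intro light_add light_sum) auto
    have "sum c L = c l1 + (c l2 + sum c (L - {l1} - {l2}))"
      using l12 L(3) by (simp add: sum.remove)
    also have "sum c (L - {l1} - {l2}) = (\<Sum>l\<in>L - {l1} - {l2}. 3)"
      unfolding c_def by (intro sum.cong) auto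
    also have "\<dots> = 3 * (h - 2)" using l12 L by simp
    finally have sc: "sum c L = 4 + 3 * (h - 2)" unfolding c_def by simp
    have "card {l1, l2} \<le> h" using l12 L by (metis card_mono empty_subsetI insert_subset)
    then have h2: "2 \<le> h" using l12 by simp
    \<comment> \<open>\<open>sum c L\<close> is 3 h - 2; the saving of 2 turns the required 5 * 6
      into the summand 2 of \<open>count\<close>.\<close>
    have cnt: "14 * (sum c L + (\<Sum>i<k. 1)) + 5 * 6 \<le> 7 * 6 * r" using count sc h2 by simp
    show False
    proof (rule light_contra[OF lF _ _ cnt])
      show "0 < sum c L + (\<Sum>i<k. 1)" using sc by simp
      fix v assume v: "v \<in> V"
      have nn: "(\<Sum>l\<in>L. c l * (2 - w l v)) \<le> F v" "(\<Sum>i<k. 2 - w (u i) v) \<le> F v"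
        unfolding F_def by simp_all
      show "6 \<le> F v"
      proof (cases "\<exists>l\<in>L. w l v = 0")
        case False
        then show ?thesis using misses[OF hub Q v] nn by force
      next
        case True
        then obtain l where l: "l \<in> L" "w l v = 0" by blast
        have one: "c l * 2 \<le> (\<Sum>l\<in>L. c l * (2 - w l v))"
          using member_le_sum[of l L "\<lambda>l. c l * (2 - w l v)"] l L by simp
        show ?thesis
        proof (cases "\<exists>x\<in>L - {l}. w x v \<noteq> 2")
          case True
          then obtain x where x: "x \<in> L" "x \<noteq> l" "w x v \<noteq> 2" by blast
          have "c l * (2 - w l v) + c x * (2 - w x v) \<le> (\<Sum>l\<in>L. c l * (2 - w l v))"
            using x l L member_le_sum2[of L l x "\<lambda>l. c l * (2 - w l v)"] by blast
          moreover have "2 * 1 \<le> c x * (2 - w x v)"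
            using x le2[of x v] unfolding c_def by (intro mult_mono) auto
          moreover have "4 \<le> c l * (2 - w l v)" using l unfolding c_def by auto
          ultimately show ?thesis using nn by linarith
        next
          case False
          then have vL: "\<And>x. x \<in> L - {l} \<Longrightarrow> w v x = 2" using sym by metis
          show ?thesis
          proof (cases "\<exists>i<k. w (u i) v = 0")
            case True
            then obtain i where i: "i < k" "w (u i) v = 0" by blast
            then have "2 \<le> (\<Sum>i<k. 2 - w (u i) v)"
              using member_le_sum[of i "{..<k}" "\<lambda>i. 2 - w (u i) v"] by simp
            moreover have "4 \<le> c l * 2" unfolding c_def by auto
            ultimately show ?thesis using one unfolding F_def by simp
          next
            case False
            then have vu: "\<And>i. i < k \<Longrightarrow> w v (u i) \<noteq> 0" using sym by metis
            have ex: "hub h k (insert v (L - {l})) u" "v \<notin> L - {l}"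
              using hub_exchange[OF hub v l(1) _ vu] vL by auto
            show ?thesis
            proof (cases "l = l1 \<or> l = l2")
              case False
              then show ?thesis using one nn unfolding c_def by auto
            next
              case True
              then obtain l' where l': "l' \<in> L - {l}" "w l l' \<noteq> 2"
                using l12 sym by (metis Diff_iff singletonD)
              have "f (insert v (L - {l}), u) \<le> f (insert l (L - {l}), u)"
                using max[of "(insert v (L - {l}), u)"] ex Q LuE insert_Diff[OF l(1)] unfolding P_def by simp
              then have "(\<Sum>y\<in>L - {l}. \<rho> v y) \<le> (\<Sum>y\<in>L - {l}. \<rho> l y)"
                using sum_pairs_insert[of "L - {l}" v \<rho>, OF _ ex(2) \<rho>sym \<rho>irr]
                  sum_pairs_insert[of "L - {l}" l \<rho>, OF _ _ \<rho>sym \<rho>irr] L(3)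
                unfolding f_def by simp
              moreover have "(\<Sum>y\<in>L - {l}. \<rho> l y) < (\<Sum>y\<in>L - {l}. \<rho> v y)"
                using L(3) l' vL unfolding \<rho>_def by (intro sum_strict_mono_ex1) auto
              ultimately show ?thesis by simp
            qed
          qed
        qed
      qed
    qed
  qed
  then show ?thesis using hub Q by blast
qed

text \<open>Among configurations with red \<open>L\<close>, take one with the most red edges between
  hubs and rim. Each further conclusion excludes an exchange that would raise this number: a rim
  vertex for one red to all hubs, or a hub with a non-red rim edge for a vertex red to the other
  hubs and to the whole rim.\<close>

lemma hub_red_maximal:
  assumes "\<exists>L u. hub h k L u \<and> Q u \<and> red_clique L"
  shows "\<exists>L u. hub h k L u \<and> Q u \<and> red_clique L
    \<and> (\<forall>i<k. \<forall>v\<in>V. Q (u(i := v)) \<longrightarrow> (\<forall>l\<in>L. w v l = 2) \<longrightarrow> (\<forall>l\<in>L. w (u i) l = 2))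
    \<and> (\<forall>l\<in>L. \<forall>i<k. \<forall>v\<in>V. w (u i) l \<noteq> 2 \<longrightarrow> (\<forall>x\<in>L - {l}. w v x = 2) \<longrightarrow> (\<exists>i<k. w v (u i) \<noteq> 2))"
proof -
  define \<rho> where "\<rho> x y = (if w x y = 2 then 1 else 0 :: nat)" for x y
  define P where "P Lu = (hub h k (fst Lu) (snd Lu) \<and> Q (snd Lu) \<and> red_clique (fst Lu))" for Lu
  define f where "f Lu = (\<Sum>i<k. \<Sum>l\<in>fst Lu. \<rho> (snd Lu i) l)" for Lu :: "'a set \<times> (nat \<Rightarrow> 'a)"
  have "f Lu < k * h + 1" if "P Lu" for Lu
  proof -
    have c: "card (fst Lu) = h" using that unfolding P_def hub_def by auto
    have "f Lu \<le> (\<Sum>i<k. \<Sum>y\<in>fst Lu. 1)"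
      unfolding f_def \<rho>_def by (intro sum_mono) auto
    then show ?thesis using c by simp
  qed
  moreover obtain L0 u0 where "P (L0, u0)" using assms unfolding P_def by auto
  ultimately obtain Lu where Lu: "P Lu" and max: "\<And>Lu'. P Lu' \<Longrightarrow> f Lu' \<le> f Lu"
    using Lattices_Big.ex_has_greatest_nat[of P "(L0, u0)" f "k * h + 1"] by blast
  obtain L u where LuE: "Lu = (L, u)" by force
  have hub: "hub h k L u" and Q: "Q u" and red: "red_clique L" using Lu LuE unfolding P_def by auto
  have L: "clique L" "card L = h" "finite L" "L \<subseteq> V"
    using hub clique_finite unfolding hub_def clique_def by auto
  show ?thesis
  proof (intro exI[of _ L] exI[of _ u] conjI hub Q red allI ballI impI)
    fix i v l assume i: "i < k" and v: "v \<in> V" "Q (u(i := v))" and vL': "\<forall>l\<in>L. w v l = 2" and l: "l \<in> L"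
    from vL' have vL: "\<And>l. l \<in> L \<Longrightarrow> w v l = 2" by blast
    have "P (L, u(i := v))" using hub v vL red unfolding P_def hub_def by auto
    then have le: "f (L, u(i := v)) \<le> f (L, u)" using max LuE by blast
    show "w (u i) l = 2"
    proof (rule ccontr)
      assume "w (u i) l \<noteq> 2"
      note l = l this
      have "(\<Sum>l\<in>L. \<rho> (u i) l) < (\<Sum>l\<in>L. \<rho> v l)"
        using L(3) l vL unfolding \<rho>_def by (intro sum_strict_mono_ex1) auto
      then have "f (L, u) < f (L, u(i := v))"
        unfolding f_def using i vL
        by (intro sum_strict_mono_ex1) (auto simp: \<rho>_def intro!: sum_mono bexI[of _ i])
      then show False using le by simp
    qed
  next
    fix l i v assume l: "l \<in> L" and i: "i < k" and v: "v \<in> V"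
      and i2: "w (u i) l \<noteq> 2" and "\<forall>x\<in>L - {l}. w v x = 2"
    note i = i i2
    from \<open>\<forall>x\<in>L - {l}. w v x = 2\<close> have vL: "\<And>x. x \<in> L - {l} \<Longrightarrow> w v x = 2" by blast
    show "\<exists>i<k. w v (u i) \<noteq> 2"
    proof (rule ccontr)
      assume "\<not> (\<exists>i<k. w v (u i) \<noteq> 2)"
      then have vu: "\<And>i. i < k \<Longrightarrow> w v (u i) = 2" by blast
      have ex: "hub h k (insert v (L - {l})) u" "v \<notin> L - {l}"
        using hub_exchange[OF hub v l] vL vu by auto
      have "red_clique (insert v (L - {l}))"
        using red_clique_insert[OF v red_clique_mono[OF red]] vL by blast
      then have le: "f (insert v (L - {l}), u) \<le> f (insert l (L - {l}), u)"
        using max[of "(insert v (L - {l}), u)"] ex Q LuE insert_Diff[OF l] unfolding P_def by simp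
      have uv: "\<rho> (u j) v = 1" if "j < k" for j unfolding \<rho>_def using vu[OF that] sym by metis
      have "(\<Sum>j<k. \<rho> (u j) l) < (\<Sum>j<k. \<rho> (u j) v)"
        using i uv by (intro sum_strict_mono_ex1) (auto simp: \<rho>_def)
      moreover have ins: "(\<Sum>y\<in>insert z (L - {l}). g y) = g z + (\<Sum>y\<in>L - {l}. g y)"
        if "z \<notin> L - {l}" for z and g :: "'a \<Rightarrow> nat"
        using L(3) that by simp
      have "l \<notin> L - {l}" by blast
      from le[unfolded f_def fst_conv snd_conv ins[OF ex(2)] ins[OF this] sum.distrib]
      have "(\<Sum>j<k. \<rho> (u j) v) \<le> (\<Sum>j<k. \<rho> (u j) l)" by simp
      ultimately show False by simp
    qed
  qed
qed

text \<open>
  Each hub has multiplicity q, except that l0 has q - d. This gain is affordable if a vertex green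
  to l0 cannot be red to everything else, so that it has a further deficit of at least 2 d.
\<close>
lemma hub_contra:
  assumes hub: "hub h k L u"
    and red: "\<And>v. v \<in> V \<Longrightarrow> (\<And>l. l \<in> L \<Longrightarrow> w v l = 2) \<Longrightarrow> 2 * q \<le> (\<Sum>i<k. c i * (2 - w (u i) v))"
    and nonred: "\<And>v. v \<in> V \<Longrightarrow> (\<And>l. l \<in> L \<Longrightarrow> w v l \<noteq> 0) \<Longrightarrow> q + d \<le> (\<Sum>i<k. c i * (2 - w (u i) v))"
    and l0: "d = 0 \<or> l0 \<in> L"
    and d: "2 * d \<le> q" "\<And>i. i < k \<Longrightarrow> 2 * d \<le> c i"
    and l0v: "\<And>v. d \<noteq> 0 \<Longrightarrow> v \<in> V \<Longrightarrow> (\<And>x. x \<in> L - {l0} \<Longrightarrow> w v x = 2) \<Longrightarrow> \<exists>i<k. w v (u i) \<noteq> 2"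
    and count: "14 * (q * h + (\<Sum>i<k. c i)) + 10 * q \<le> 14 * q * r + 14 * d"
    and pos: "0 < (\<Sum>i<k. c i)"
  shows False
proof -
  have L: "clique L" "card L = h" "finite L" "L \<subseteq> V"
    using hub clique_finite unfolding hub_def clique_def by auto
  have uV: "u i \<in> V" if "i < k" for i using hub that unfolding hub_def by blast
  define cL where "cL l = (if l = l0 then q - d else q)" for l
  define F where "F v = (\<Sum>l\<in>L. cL l * (2 - w l v)) + (\<Sum>i<k. c i * (2 - w (u i) v))" for v
  have lF: "light F (sum cL L + (\<Sum>i<k. c i))"
    unfolding F_def using L uV by (intro light_add light_sum) auto
  have "sum cL L + d = q * h"
  proof (cases "l0 \<in> L")
    case True
    then have "sum cL L = cL l0 + sum cL (L - {l0})" using L(3) by (simp add: sum.remove)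
    also have "sum cL (L - {l0}) = (\<Sum>l\<in>L - {l0}. q)"
      unfolding cL_def by (intro sum.cong) auto
    finally have s: "sum cL L + d = q + q * (h - 1)" unfolding cL_def using L True d(1) by simp
    have "h \<noteq> 0" using True L by (metis card_0_eq empty_iff)
    then show ?thesis using s by (cases h) auto
  next
    case False
    then have "sum cL L = (\<Sum>l\<in>L. q)" unfolding cL_def by (intro sum.cong) auto
    then show ?thesis using False l0 L by simp
  qed
  then have cnt: "14 * (sum cL L + (\<Sum>i<k. c i)) + 5 * (2 * q) \<le> 7 * (2 * q) * r"
    using count by (simp add: algebra_simps)
  have qd: "q - d \<le> cL l" for l unfolding cL_def by simp
  show False
  proof (rule light_contra[OF lF _ _ cnt])
    show "0 < sum cL L + (\<Sum>i<k. c i)" using pos by simp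
    fix v assume v: "v \<in> V"
    show "2 * q \<le> F v"
    proof (cases "\<exists>l\<in>L. w v l = 0")
      case False
      show ?thesis
      proof (cases "\<exists>l\<in>L. w v l \<noteq> 2")
        case True
        then obtain l where l: "l \<in> L" "w l v \<noteq> 2" using sym by metis
        \<comment> \<open>One hub that is blue to \<open>v\<close> gives at least
          \<open>q - d\<close>, so \<open>nonred\<close> only has to supply \<open>q + d\<close> on
          the rim.\<close>
        have "(q - d) * 1 \<le> cL l * (2 - w l v)"
          using l qd le2[of l v] by (intro mult_mono) auto
        also have "\<dots> \<le> (\<Sum>l\<in>L. cL l * (2 - w l v))"
          using l L by (intro member_le_sum) auto
        finally show ?thesis using nonred[OF v] False d(1) unfolding F_def by fastforce
      next
        case False
        then show ?thesis using red[OF v] unfolding F_def by fastforce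
      qed
    next
      case True
      then obtain l where l: "l \<in> L" "w l v = 0" using sym by metis
      have one: "2 * cL l \<le> (\<Sum>l\<in>L. cL l * (2 - w l v))"
        using member_le_sum[of l L "\<lambda>l. cL l * (2 - w l v)"] l L by simp
      show ?thesis
      proof (cases "d = 0 \<or> l \<noteq> l0")
        case True
        then have "cL l = q" unfolding cL_def by auto
        then show ?thesis using one unfolding F_def by simp
      next
        case False
        then have l0: "l = l0" and d0: "d \<noteq> 0" by auto
        have cl: "cL l = q - d" using l0 unfolding cL_def by simp
        show ?thesis
        proof (cases "\<exists>x\<in>L - {l0}. w v x \<noteq> 2")
          case True
          then obtain x where x: "x \<in> L" "x \<noteq> l" "w x v \<noteq> 2" using l0 sym by (metis Diff_iff insertI1)
          have "cL l * (2 - w l v) + cL x * (2 - w x v) \<le> (\<Sum>l\<in>L. cL l * (2 - w l v))"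
            using x l L member_le_sum2[of L l x "\<lambda>l. cL l * (2 - w l v)"] by blast
          moreover have "q * 1 \<le> cL x * (2 - w x v)"
            using x l0 le2[of x v] unfolding cL_def by (intro mult_mono) auto
          ultimately show ?thesis using l cl d(1) unfolding F_def by simp
        next
          case False
          then obtain i where i: "i < k" "w (u i) v \<noteq> 2" using l0v[OF d0 v] sym by metis
          have "2 * d * 1 \<le> c i * (2 - w (u i) v)"
            using i d(2) le2[of "u i" v] by (intro mult_mono) auto
          also have "\<dots> \<le> (\<Sum>i<k. c i * (2 - w (u i) v))"
            using i by (intro member_le_sum) auto
          finally show ?thesis using one cl d(1) unfolding F_def by simp
        qed
      qed
    qed
  qed
qed

end

subsection \<open>Wheels\<close>

lemma All_less_5: "(\<forall>i<5::nat. P i) \<longleftrightarrow> P 0 \<and> P 1 \<and> P 2 \<and> P 3 \<and> P 4"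
  by (auto simp: numeral_eq_Suc All_less_Suc)

lemma sum_less_5: "(\<Sum>i<5. f i) = f 0 + f 1 + f 2 + f 3 + f (4::nat)" for f :: "nat \<Rightarrow> nat"
  by (simp add: numeral_eq_Suc)

lemma sum_less_7: "(\<Sum>i<7. f i) = f 0 + f 1 + f 2 + f 3 + f 4 + f 5 + f (6::nat)" for f :: "nat \<Rightarrow> nat"
  by (simp add: numeral_eq_Suc)

text \<open>The numbers are deficits around the rim, 2 meaning green; a vertex cover of a 5-cycle
  has at least three vertices.\<close>

lemma wheel_deficit_6:
  fixes a b c d e :: nat
  assumes "a = 2 \<or> b = 2" "b = 2 \<or> c = 2" "c = 2 \<or> d = 2" "d = 2 \<or> e = 2" "e = 2 \<or> a = 2"
  shows "6 \<le> a + b + c + d + e"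
  using assms by arith

text \<open>\<open>A\<close>, ..., \<open>E\<close> mark the rim vertices that are red to all hubs.
  Four values 2 give 8. With only three, the uncovered vertices have a common neighbour; it is
  marked, hence one of its neighbours, both uncovered, is marked too and adds at least 1.\<close>

lemma wheel_deficit_7:
  fixes a b c d e :: nat
  assumes "a = 2 \<or> b = 2" "b = 2 \<or> c = 2" "c = 2 \<or> d = 2" "d = 2 \<or> e = 2" "e = 2 \<or> a = 2"
    and "A \<longrightarrow> a \<noteq> 0" "B \<longrightarrow> b \<noteq> 0" "C \<longrightarrow> c \<noteq> 0" "D \<longrightarrow> d \<noteq> 0" "E \<longrightarrow> e \<noteq> 0"
    and "e = 2 \<or> b = 2 \<or> A" "a = 2 \<or> c = 2 \<or> B" "b = 2 \<or> d = 2 \<or> C" "c = 2 \<or> e = 2 \<or> D" "d = 2 \<or> a = 2 \<or> E"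
    and "A \<longrightarrow> E \<or> B" "B \<longrightarrow> A \<or> C" "C \<longrightarrow> B \<or> D" "D \<longrightarrow> C \<or> E" "E \<longrightarrow> D \<or> A"
  shows "7 \<le> a + b + c + d + e"
proof -
  have "A \<Longrightarrow> 1 \<le> a" "B \<Longrightarrow> 1 \<le> b" "C \<Longrightarrow> 1 \<le> c" "D \<Longrightarrow> 1 \<le> d" "E \<Longrightarrow> 1 \<le> e"
    using assms(6-10) by auto
  then show ?thesis using assms(1-5,11-20)
    by (cases "a = 2"; cases "b = 2"; cases "c = 2"; cases "d = 2"; cases "e = 2"; simp; force)
qed

text \<open>\<open>a\<close> belongs to a marked vertex between two unmarked ones. If it is 2, two
  of the others are 2 as well, and 36 + 20 = 56. Otherwise it is at least 1 and all four others are
  2, giving at least 18 + 40.\<close>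

lemma wheel_deficit_56:
  fixes a b c d e :: nat
  assumes "a = 2 \<or> b = 2" "b = 2 \<or> c = 2" "c = 2 \<or> d = 2" "d = 2 \<or> e = 2" "e = 2 \<or> a = 2"
    and "a \<noteq> 0" "a = 2 \<or> c = 2"  "d = 2 \<or> a = 2"
  shows "56 \<le> 18 * a + 5 * b + 5 * c + 5 * d + 5 * e"
  using assms by arith

lemma wheel_deficit_30:
  fixes a b c d e :: nat
  assumes "a = 2 \<or> b = 2" "b = 2 \<or> c = 2" "c = 2 \<or> d = 2" "d = 2 \<or> e = 2" "e = 2 \<or> a = 2"
  shows "30 \<le> 18 * a + 5 * b + 5 * c + 5 * d + 5 * e"
  using assms by arith


section \<open>Deficits of a vertex towards a Moser spindle\<close>

lemma All_less_7: "(\<forall>i<7::nat. P i) \<longleftrightarrow> P 0 \<and> P 1 \<and> P 2 \<and> P 3 \<and> P 4 \<and> P 5 \<and> P 6"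
  by (auto simp: numeral_eq_Suc All_less_Suc)

text \<open>\<open>y\<close> is the deficit at the apex, \<open>a\<close>, \<open>a'\<close> and
  \<open>b\<close>, \<open>b'\<close> those at the two edges forming triangles with it,
  \<open>x\<close> and \<open>z\<close> those at the reflected apices. The green positions hit the
  four triangles (\<open>tri\<close>) and the four 5-cycles through \<open>x\<close>,
  \<open>y\<close>, \<open>z\<close> (\<open>wh\<close>).\<close>

context
  fixes y a a' b b' x z :: nat
  assumes tri: "y = 2 \<or> a = 2 \<or> a' = 2" "x = 2 \<or> a = 2 \<or> a' = 2" "y = 2 \<or> b = 2 \<or> b' = 2" "z = 2 \<or> b = 2 \<or> b' = 2"
    and wh: "x = 2 \<or> y = 2 \<or> z = 2 \<or> a = 2 \<or> b = 2" "x = 2 \<or> y = 2 \<or> z = 2 \<or> a = 2 \<or> b' = 2"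
      "x = 2 \<or> y = 2 \<or> z = 2 \<or> a' = 2 \<or> b = 2" "x = 2 \<or> y = 2 \<or> z = 2 \<or> a' = 2 \<or> b' = 2"
begin

text \<open>If the apex is hit, the triangles at \<open>x\<close> and \<open>z\<close> remain. If
  not, each of the two edges has a hit end, and two such ends leave one 5-cycle, which requires a
  third vertex. So at least three vertices are hit.\<close>

lemma spindle_cases:
  "y = 2 \<and> (x = 2 \<or> a = 2 \<or> a' = 2) \<and> (z = 2 \<or> b = 2 \<or> b' = 2)
    \<or> a = 2 \<and> b = 2 \<and> (x = 2 \<or> z = 2 \<or> a' = 2 \<or> b' = 2)
    \<or> a = 2 \<and> b' = 2 \<and> (x = 2 \<or> z = 2 \<or> a' = 2 \<or> b = 2)
    \<or> a' = 2 \<and> b = 2 \<and> (x = 2 \<or> z = 2 \<or> a = 2 \<or> b' = 2)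
    \<or> a' = 2 \<and> b' = 2 \<and> (x = 2 \<or> z = 2 \<or> a = 2 \<or> b = 2)"
  using tri wh by argo

lemma spindle_deficit_6: "6 \<le> y + a + a' + b + b' + x + z"
  using spindle_cases by (elim disjE conjE; auto)

lemma spindle_deficit_14: "14 \<le> 3 * y + 3 * a + 3 * a' + 2 * b + 2 * b' + 2 * x + 2 * z"
  using spindle_cases by (elim disjE conjE; auto)

text \<open>With the apex hit the sum is at least 16. Otherwise three hit vertices give 12, and as
  all coefficients are even, a sum below 14 leaves deficit 0 at the four other vertices. The second
  disjunct keeps three of these: the apex, a reflected apex and one end of the edge between
  them.\<close>

lemma spindle_deficit_centre:
  "14 \<le> 4 * y + 2 * a + 2 * a' + 2 * b + 2 * b' + 2 * x + 2 * z
    \<or> y = 0 \<and> (b' = 0 \<and> z = 0 \<or> b = 0 \<and> z = 0 \<or> a = 0 \<and> x = 0 \<or> a' = 0 \<and> x = 0)"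
  using spindle_cases by (elim disjE conjE; auto)

text \<open>Deficit 0 means red; the hypotheses exclude red triangles on \<open>v\<close> and an
  edge from the vertex at \<open>b\<close> to its neighbours. If \<open>b\<close> is 0, each of
  \<open>y\<close>, \<open>b'\<close>, \<open>z\<close> is positive, and this replaces the missing
  contribution of \<open>b\<close>.\<close>

lemma spindle_deficit_perfect:
  assumes "b \<noteq> 0 \<or> y \<noteq> 0" "b \<noteq> 0 \<or> b' \<noteq> 0" "b \<noteq> 0 \<or> z \<noteq> 0"
  shows "14 \<le> 2 * y + 2 * a + 2 * a' + 4 * b + 2 * b' + 2 * x + 2 * z"
proof (cases "b = 0")
  case True
  then have 1: "1 \<le> y" "1 \<le> b'" "1 \<le> z" using assms by auto
  from True have "b \<noteq> 2" by simp
  then have "y = 2 \<and> (x = 2 \<or> a = 2 \<or> a' = 2) \<and> (z = 2 \<or> b' = 2)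
    \<or> a = 2 \<and> b' = 2 \<and> (x = 2 \<or> z = 2 \<or> a' = 2)
    \<or> a' = 2 \<and> b' = 2 \<and> (x = 2 \<or> z = 2 \<or> a = 2)"
    using spindle_cases by argo
  then show ?thesis using 1 by (elim disjE conjE; simp)
next
  case False
  then have "1 \<le> b" by simp
  then show ?thesis using spindle_cases by (elim disjE conjE; simp)
qed

end

section \<open>Wheels with r - 2 hubs\<close>

context weighted_free
begin

text \<open>Recorded as a closed walk of five non-green edges, so that replacing one vertex only
  involves the two edges at it.\<close>

definition wheel_rim :: "(nat \<Rightarrow> 'a) \<Rightarrow> bool" where
  "wheel_rim u \<longleftrightarrow> w (u 0) (u 1) \<noteq> 0 \<and> w (u 1) (u 2) \<noteq> 0 \<and> w (u 2) (u 3) \<noteq> 0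
    \<and> w (u 3) (u 4) \<noteq> 0 \<and> w (u 4) (u 0) \<noteq> 0"

text \<open>A rim edge, the r - 2 hubs and \<open>v\<close> would otherwise form a clique of size r
  + 1.\<close>

lemma wheel_misses:
  assumes hub: "hub h 5 L u" and h: "h + 2 = r" and rim: "wheel_rim u"
    and vL: "\<And>l. l \<in> L \<Longrightarrow> w l v \<noteq> 0"
  shows "2 - w (u 0) v = 2 \<or> 2 - w (u 1) v = 2" "2 - w (u 1) v = 2 \<or> 2 - w (u 2) v = 2"
    "2 - w (u 2) v = 2 \<or> 2 - w (u 3) v = 2" "2 - w (u 3) v = 2 \<or> 2 - w (u 4) v = 2"
    "2 - w (u 4) v = 2 \<or> 2 - w (u 0) v = 2"
proof -
  have L: "clique L" "card L = h" using hub unfolding hub_def by auto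
  have vL': "w v l \<noteq> 0" if "l \<in> L" for l using vL[OF that] sym[of v l] by simp
  have "w (u i) v = 0 \<or> w (u j) v = 0" if ij: "i < 5" "j < 5" "w (u i) (u j) \<noteq> 0" for i j
  proof (rule ccontr)
    assume "\<not> (w (u i) v = 0 \<or> w (u j) v = 0)"
    then have "card L + 3 \<le> r"
      using hub ij vL' by (intro triangle_card[OF L(1), of "u i" "u j" v]) (auto simp: hub_def)
    then show False using h L by simp
  qed
  from this[of 0 1] this[of 1 2] this[of 2 3] this[of 3 4] this[of 4 0] rim
  show "2 - w (u 0) v = 2 \<or> 2 - w (u 1) v = 2" "2 - w (u 1) v = 2 \<or> 2 - w (u 2) v = 2"
    "2 - w (u 2) v = 2 \<or> 2 - w (u 3) v = 2" "2 - w (u 3) v = 2 \<or> 2 - w (u 4) v = 2"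
    "2 - w (u 4) v = 2 \<or> 2 - w (u 0) v = 2"
    unfolding wheel_rim_def by auto
qed

text \<open>Two facts about a vertex \<open>v\<close> red to all hubs go beyond the cover bound 6.
  By \<open>full\<close>, it is not red to a rim vertex that is itself red to all hubs, since this
  would give a red clique of size r. By \<open>mid\<close>, it is green to a neighbour of every
  other rim vertex. How much this gains depends on the pattern of \<open>T\<close> around the
  rim.\<close>

lemma no_wheel_hub:
  assumes hub0: "hub h 5 L0 u0" and h: "h + 2 = r" and rim0: "wheel_rim u0"
  shows False
proof -
  have "\<exists>L u. hub h 5 L u \<and> wheel_rim u \<and> red_clique L"
  proof (rule hub_red_exists[where Q = wheel_rim, OF _ _ hub0 rim0])
    fix L u v assume "hub h 5 L u" "wheel_rim u" "\<And>l. l \<in> L \<Longrightarrow> w l v \<noteq> 0"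
    from wheel_deficit_6[OF wheel_misses[OF this(1) h this(2,3)]]
    show "6 \<le> (\<Sum>i<5. 2 - w (u i) v)" unfolding sum_less_5 by simp
  qed (use h in simp)
  from hub_red_maximal[OF this] obtain L u where hub: "hub h 5 L u" and rim: "wheel_rim u" and red: "red_clique L"
    and max_rim: "\<forall>i<5. \<forall>v\<in>V. wheel_rim (u(i := v)) \<longrightarrow> (\<forall>l\<in>L. w v l = 2) \<longrightarrow> (\<forall>l\<in>L. w (u i) l = 2)"
    and max_hub: "\<forall>l\<in>L. \<forall>i<5. \<forall>v\<in>V. w (u i) l \<noteq> 2 \<longrightarrow> (\<forall>x\<in>L - {l}. w v x = 2)
      \<longrightarrow> (\<exists>i<5. w v (u i) \<noteq> 2)"
    by blast
  have L: "card L = h" using hub unfolding hub_def by auto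
  \<comment> \<open>The multiplicities depend on which rim vertices are red to all hubs.\<close>
  define T where "T i \<longleftrightarrow> (\<forall>l\<in>L. w (u i) l = 2)" for i
  define d where "d v i = 2 - w (u i) v" for v i
  have adj: "d v i = 2 \<or> w v (u i) \<noteq> 0" for v i unfolding d_def using sym[of v "u i"]
    by (cases "w (u i) v = 0") auto
  have cyc: "d v 0 = 2 \<or> d v 1 = 2" "d v 1 = 2 \<or> d v 2 = 2" "d v 2 = 2 \<or> d v 3 = 2"
      "d v 3 = 2 \<or> d v 4 = 2" "d v 4 = 2 \<or> d v 0 = 2"
    if "\<And>l. l \<in> L \<Longrightarrow> w v l \<noteq> 0" for v
    using wheel_misses[OF hub h rim, of v] that sym unfolding d_def by metis+
  have full: "T i \<longrightarrow> d v i \<noteq> 0" if vL: "\<And>l. l \<in> L \<Longrightarrow> w v l = 2" for v i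
  proof
    assume T: "T i"
    show "d v i \<noteq> 0"
    proof
      assume "d v i = 0"
      then have "w (u i) v = 2" using le2[of "u i" v] unfolding d_def by simp
      then have "card L + 2 < r" using red_edge_card[OF red, of "u i" v] T vL unfolding T_def by blast
      then show False using L h by simp
    qed
  qed
  \<comment> \<open>If \<open>v\<close> is non-green to both rim neighbours of \<open>u i\<close>,
    it can take the place of \<open>u i\<close>; maximality then makes \<open>u i\<close> red to all
    hubs.\<close>
  have mid: "d v 4 = 2 \<or> d v 1 = 2 \<or> T 0" "d v 0 = 2 \<or> d v 2 = 2 \<or> T 1" "d v 1 = 2 \<or> d v 3 = 2 \<or> T 2"
      "d v 2 = 2 \<or> d v 4 = 2 \<or> T 3" "d v 3 = 2 \<or> d v 0 = 2 \<or> T 4"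
    if v: "v \<in> V" and vL: "\<And>l. l \<in> L \<Longrightarrow> w v l = 2" for v
  proof -
    have T: "T i" if "i < 5" "wheel_rim (u(i := v))" for i
      unfolding T_def using max_rim that v vL by blast
    have adj': "d v i = 2 \<or> w v (u i) \<noteq> 0 \<and> w (u i) v \<noteq> 0" for i
      using adj[of v i] sym[of v "u i"] by auto
    show "d v 4 = 2 \<or> d v 1 = 2 \<or> T 0" using T[of 0] adj'[of 4] adj'[of 1] rim unfolding wheel_rim_def by auto
    show "d v 0 = 2 \<or> d v 2 = 2 \<or> T 1" using T[of 1] adj'[of 0] adj'[of 2] rim unfolding wheel_rim_def by auto
    show "d v 1 = 2 \<or> d v 3 = 2 \<or> T 2" using T[of 2] adj'[of 1] adj'[of 3] rim unfolding wheel_rim_def by auto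
    show "d v 2 = 2 \<or> d v 4 = 2 \<or> T 3" using T[of 3] adj'[of 2] adj'[of 4] rim unfolding wheel_rim_def by auto
    show "d v 3 = 2 \<or> d v 0 = 2 \<or> T 4" using T[of 4] adj'[of 3] adj'[of 0] rim unfolding wheel_rim_def by auto
  qed
  show False
  proof (cases "\<forall>i<5. T i")
    case True
    then have T: "T 0" "T 1" "T 2" "T 3" "T 4" unfolding All_less_5 by auto
    show False
    \<comment> \<open>All five deficits are positive and three of them are 2, so the sum is at least
      8 = 2 q. The rim total 5 is below 9 q / 7.\<close>
    proof (rule hub_contra[OF hub, where q = 4 and d = 0 and c = "\<lambda>_. 1"])
      fix v assume "v \<in> V" and vL: "\<And>l. l \<in> L \<Longrightarrow> w v l = 2"
      then have c: "\<And>l. l \<in> L \<Longrightarrow> w v l \<noteq> 0" by simp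
      have "d v 0 \<noteq> 0" "d v 1 \<noteq> 0" "d v 2 \<noteq> 0" "d v 3 \<noteq> 0" "d v 4 \<noteq> 0"
        using full[OF vL] T by blast+
      then have "8 \<le> d v 0 + d v 1 + d v 2 + d v 3 + d v 4" using cyc[OF c] by linarith
      then show "2 * 4 \<le> (\<Sum>i<5. 1 * (2 - w (u i) v))" unfolding sum_less_5 d_def by simp
    next
      fix v assume "\<And>l. l \<in> L \<Longrightarrow> w v l \<noteq> 0"
      from wheel_deficit_6[OF cyc[OF this]]
      show "4 + 0 \<le> (\<Sum>i<5. 1 * (2 - w (u i) v))" unfolding sum_less_5 d_def by simp
    qed (use h in auto)
  next
    case False
    then obtain i0 l0 where l0: "i0 < 5" "l0 \<in> L" "w (u i0) l0 \<noteq> 2" unfolding T_def by blast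
    have mh: "\<exists>i<5. w v (u i) \<noteq> 2" if "v \<in> V" "\<And>x. x \<in> L - {l0} \<Longrightarrow> w v x = 2" for v
      using max_hub l0 that by blast
    show False
    proof (cases "(T 0 \<longrightarrow> T 4 \<or> T 1) \<and> (T 1 \<longrightarrow> T 0 \<or> T 2) \<and> (T 2 \<longrightarrow> T 1 \<or> T 3) \<and> (T 3 \<longrightarrow> T 2 \<or> T 4) \<and> (T 4 \<longrightarrow> T 3 \<or> T 0)")
      case True
      show False
      \<comment> \<open>The rim total 10 exceeds 9 q / 7 = 9 by exactly the discount
        \<open>d\<close>, so \<open>count\<close> holds with equality.\<close>
      proof (rule hub_contra[OF hub, where q = 7 and d = 1 and c = "\<lambda>_. 2" and ?l0.0 = l0])
        fix v assume v: "v \<in> V" and vL: "\<And>l. l \<in> L \<Longrightarrow> w v l = 2"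
        then have c: "\<And>l. l \<in> L \<Longrightarrow> w v l \<noteq> 0" by simp
        have "7 \<le> d v 0 + d v 1 + d v 2 + d v 3 + d v 4"
          using wheel_deficit_7[OF cyc[OF c] full[OF vL] full[OF vL] full[OF vL] full[OF vL] full[OF vL] mid[OF v vL]] True
          by simp
        then show "2 * 7 \<le> (\<Sum>i<5. 2 * (2 - w (u i) v))" unfolding sum_less_5 d_def by simp
      next
        fix v assume "\<And>l. l \<in> L \<Longrightarrow> w v l \<noteq> 0"
        from wheel_deficit_6[OF cyc[OF this]]
        show "7 + 1 \<le> (\<Sum>i<5. 2 * (2 - w (u i) v))" unfolding sum_less_5 d_def by simp
      qed (use h l0 mh in auto)
    next
      case False
      then obtain j where j: "j = 0 \<and> T 0 \<and> \<not> T 4 \<and> \<not> T 1 \<or> j = 1 \<and> T 1 \<and> \<not> T 0 \<and> \<not> T 2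
          \<or> j = 2 \<and> T 2 \<and> \<not> T 1 \<and> \<not> T 3 \<or> j = 3 \<and> T 3 \<and> \<not> T 2 \<and> \<not> T 4 \<or> j = (4::nat) \<and> T 4 \<and> \<not> T 3 \<and> \<not> T 0"
        by blast
      \<comment> \<open>The large multiplicity sits on a vertex \<open>u j\<close> satisfying
        \<open>T\<close> whose rim neighbours do not. The total 18 + 4 * 5 = 38 equals 9 q / 7 + d
        for q = 28 and d = 2, again with equality in \<open>count\<close>.\<close>
      define c where "c i = (if i = j then 18 else 5::nat)" for i
      have sc: "(\<Sum>i<5. c i) = 38" unfolding sum_less_5 c_def using j by auto
      show False
      proof (rule hub_contra[OF hub, where q = 28 and d = 2 and c = c and ?l0.0 = l0])
        fix v assume v: "v \<in> V" and vL: "\<And>l. l \<in> L \<Longrightarrow> w v l = 2"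
        then have nz: "\<And>l. l \<in> L \<Longrightarrow> w v l \<noteq> 0" by simp
        note cy = cyc[OF nz] and fu = full[OF vL] and mi = mid[OF v vL]
        have "56 \<le> c 0 * d v 0 + c 1 * d v 1 + c 2 * d v 2 + c 3 * d v 3 + c 4 * d v 4"
          using j
        proof (elim disjE conjE)
          assume "j = 0" "T 0" "\<not> T 4" "\<not> T 1"
          then show ?thesis using wheel_deficit_56[of "d v 0" "d v 1" "d v 2" "d v 3" "d v 4"] cy fu mi
            unfolding c_def by simp
        next
          assume "j = 1" "T 1" "\<not> T 0" "\<not> T 2"
          then show ?thesis using wheel_deficit_56[of "d v 1" "d v 2" "d v 3" "d v 4" "d v 0"] cy fu mi
            unfolding c_def by simp
        next
          assume "j = 2" "T 2" "\<not> T 1" "\<not> T 3"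
          then show ?thesis using wheel_deficit_56[of "d v 2" "d v 3" "d v 4" "d v 0" "d v 1"] cy fu mi
            unfolding c_def by simp
        next
          assume "j = 3" "T 3" "\<not> T 2" "\<not> T 4"
          then show ?thesis using wheel_deficit_56[of "d v 3" "d v 4" "d v 0" "d v 1" "d v 2"] cy fu mi
            unfolding c_def by simp
        next
          assume "j = 4" "T 4" "\<not> T 3" "\<not> T 0"
          then show ?thesis using wheel_deficit_56[of "d v 4" "d v 0" "d v 1" "d v 2" "d v 3"] cy fu mi
            unfolding c_def by simp
        qed
        then show "2 * 28 \<le> (\<Sum>i<5. c i * (2 - w (u i) v))" unfolding sum_less_5 d_def by simp
      next
        fix v assume nz: "\<And>l. l \<in> L \<Longrightarrow> w v l \<noteq> 0"
        note cy = cyc[OF nz]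
        have "30 \<le> c 0 * d v 0 + c 1 * d v 1 + c 2 * d v 2 + c 3 * d v 3 + c 4 * d v 4"
          using j
          by (elim disjE conjE)
            (use cy wheel_deficit_30[of "d v 0" "d v 1" "d v 2" "d v 3" "d v 4"]
              wheel_deficit_30[of "d v 1" "d v 2" "d v 3" "d v 4" "d v 0"]
              wheel_deficit_30[of "d v 2" "d v 3" "d v 4" "d v 0" "d v 1"]
              wheel_deficit_30[of "d v 3" "d v 4" "d v 0" "d v 1" "d v 2"]
              wheel_deficit_30[of "d v 4" "d v 0" "d v 1" "d v 2" "d v 3"] in \<open>simp_all add: c_def\<close>)
        then show "28 + 2 \<le> (\<Sum>i<5. c i * (2 - w (u i) v))" unfolding sum_less_5 d_def by simp
      next
        show "14 * (28 * h + (\<Sum>i<5. c i)) + 10 * 28 \<le> 14 * 28 * r + 14 * 2" using h sc by simp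
        show "0 < (\<Sum>i<5. c i)" using sc by simp
        show "2 * 2 \<le> c i" for i unfolding c_def by simp
      qed (use l0 mh in auto)
    qed
  qed
qed

lemma no_wheel:
  assumes L: "clique L" "card L + 2 = r"
    and adj: "\<And>l. l \<in> L \<Longrightarrow> w a l \<noteq> 0 \<and> w b l \<noteq> 0 \<and> w c l \<noteq> 0 \<and> w d l \<noteq> 0 \<and> w e l \<noteq> 0"
    and rim: "w a b \<noteq> 0" "w b c \<noteq> 0" "w c d \<noteq> 0" "w d e \<noteq> 0" "w e a \<noteq> 0"
  shows False
proof -
  define u where "u i = [a, b, c, d, e] ! i" for i
  have u: "u 0 = a" "u 1 = b" "u 2 = c" "u 3 = d" "u 4 = e" unfolding u_def by (simp_all add: numeral_eq_Suc)
  have V: "a \<in> V" "b \<in> V" "c \<in> V" "d \<in> V" "e \<in> V" using supp rim by blast+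
  have "\<forall>i<5. u i \<in> V \<and> (\<forall>l\<in>L. w (u i) l \<noteq> 0)"
    unfolding All_less_5 u using V adj by blast
  then have "hub (card L) 5 L u" using L unfolding hub_def by blast
  moreover have "wheel_rim u" unfolding wheel_rim_def u using rim by blast
  ultimately show False using no_wheel_hub L(2) by blast
qed

subsection \<open>Moser spindles\<close>


text \<open>
  Indices: 0 is the apex, {1, 2} and {3, 4} are the edges completing triangles with it, and 5, 6 are
  the reflections of the apex in these edges.
\<close>
definition spindle :: "(nat \<Rightarrow> 'a) \<Rightarrow> bool" where
  "spindle u \<longleftrightarrow> w (u 0) (u 1) \<noteq> 0 \<and> w (u 0) (u 2) \<noteq> 0 \<and> w (u 1) (u 2) \<noteq> 0
    \<and> w (u 5) (u 1) \<noteq> 0 \<and> w (u 5) (u 2) \<noteq> 0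
    \<and> w (u 0) (u 3) \<noteq> 0 \<and> w (u 0) (u 4) \<noteq> 0 \<and> w (u 3) (u 4) \<noteq> 0
    \<and> w (u 6) (u 3) \<noteq> 0 \<and> w (u 6) (u 4) \<noteq> 0 \<and> w (u 5) (u 6) \<noteq> 0"

text \<open>Being green to no hub, \<open>v\<close> acts as a further hub. With r - 2 hubs, a
  triangle gives a clique of size r + 1 and a 5-cycle gives a wheel, so \<open>v\<close> is green to
  a vertex of each triangle and each 5-cycle listed.\<close>

lemma spindle_misses:
  assumes hub: "hub h 7 L u" and h: "h + 3 = r" and sp: "spindle u"
    and vL: "\<And>l. l \<in> L \<Longrightarrow> w l v \<noteq> 0" and v: "v \<in> V"
  defines "d \<equiv> \<lambda>i. 2 - w (u i) v"
  shows "d 0 = 2 \<or> d 1 = 2 \<or> d 2 = 2" "d 5 = 2 \<or> d 1 = 2 \<or> d 2 = 2"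
    "d 0 = 2 \<or> d 3 = 2 \<or> d 4 = 2" "d 6 = 2 \<or> d 3 = 2 \<or> d 4 = 2"
    "d 5 = 2 \<or> d 0 = 2 \<or> d 6 = 2 \<or> d 1 = 2 \<or> d 3 = 2" "d 5 = 2 \<or> d 0 = 2 \<or> d 6 = 2 \<or> d 1 = 2 \<or> d 4 = 2"
    "d 5 = 2 \<or> d 0 = 2 \<or> d 6 = 2 \<or> d 2 = 2 \<or> d 3 = 2" "d 5 = 2 \<or> d 0 = 2 \<or> d 6 = 2 \<or> d 2 = 2 \<or> d 4 = 2"
proof -
  have L: "clique L" "card L = h" using hub unfolding hub_def by auto
  have uL: "\<And>i l. i < 7 \<Longrightarrow> l \<in> L \<Longrightarrow> w (u i) l \<noteq> 0" using hub unfolding hub_def by blast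
  have vL': "w v l \<noteq> 0" if "l \<in> L" for l using vL[OF that] sym[of v l] by simp
  define A where "A i \<longleftrightarrow> w (u i) v \<noteq> 0" for i
  have d: "d i = 2 \<longleftrightarrow> \<not> A i" for i using le2[of "u i" v] unfolding d_def A_def by auto
  define L' where "L' = insert v L"
  have vn: "v \<notin> L" using vL irr by blast
  have L': "clique L'" "card L' + 2 = r"
    unfolding L'_def using clique_insert[OF v L(1)] vL' vn L h clique_finite by auto
  have tri: "\<not> (A i \<and> A j \<and> A k)" if "i < 7" "j < 7" "k < 7" "w (u i) (u j) \<noteq> 0" "w (u i) (u k) \<noteq> 0" "w (u j) (u k) \<noteq> 0" for i j k
  proof
    assume "A i \<and> A j \<and> A k"
    then have "card L' + 3 \<le> r"
      using uL that by (intro triangle_card[OF L'(1), of "u i" "u j" "u k"]) (auto simp: L'_def A_def)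
    then show False using L' by simp
  qed
  have wheel: "\<not> (A 5 \<and> A i \<and> A 0 \<and> A j \<and> A 6)"
    if ij: "i < 7" "j < 7" and "w (u 5) (u i) \<noteq> 0" "w (u 0) (u i) \<noteq> 0" "w (u 0) (u j) \<noteq> 0" "w (u 6) (u j) \<noteq> 0" for i j
  proof
    assume a: "A 5 \<and> A i \<and> A 0 \<and> A j \<and> A 6"
    have s: "w (u i) (u 0) \<noteq> 0" "w (u j) (u 6) \<noteq> 0" "w (u 6) (u 5) \<noteq> 0"
      using that(4,6) sp sym[of "u i" "u 0"] sym[of "u j" "u 6"] sym[of "u 6" "u 5"]
      unfolding spindle_def by simp_all
    have adj: "w (u 5) l \<noteq> 0 \<and> w (u i) l \<noteq> 0 \<and> w (u 0) l \<noteq> 0 \<and> w (u j) l \<noteq> 0 \<and> w (u 6) l \<noteq> 0" if l: "l \<in> L'" for l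
    proof (cases "l = v")
      case True
      then show ?thesis using a unfolding A_def by blast
    next
      case False
      then have "l \<in> L" using l unfolding L'_def by blast
      then show ?thesis using uL[of 5 l] uL[of i l] uL[of 0 l] uL[of j l] uL[of 6 l] ij by simp
    qed
    show False by (rule no_wheel[OF L' adj that(3) s(1) that(5) s(2,3)])
  qed
  show "d 0 = 2 \<or> d 1 = 2 \<or> d 2 = 2" using tri[of 0 1 2] sp unfolding d spindle_def by auto
  show "d 5 = 2 \<or> d 1 = 2 \<or> d 2 = 2" using tri[of 5 1 2] sp unfolding d spindle_def by auto
  show "d 0 = 2 \<or> d 3 = 2 \<or> d 4 = 2" using tri[of 0 3 4] sp unfolding d spindle_def by auto
  show "d 6 = 2 \<or> d 3 = 2 \<or> d 4 = 2" using tri[of 6 3 4] sp unfolding d spindle_def by auto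
  show "d 5 = 2 \<or> d 0 = 2 \<or> d 6 = 2 \<or> d 1 = 2 \<or> d 3 = 2" using wheel[of 1 3] sp unfolding d spindle_def by auto
  show "d 5 = 2 \<or> d 0 = 2 \<or> d 6 = 2 \<or> d 1 = 2 \<or> d 4 = 2" using wheel[of 1 4] sp unfolding d spindle_def by auto
  show "d 5 = 2 \<or> d 0 = 2 \<or> d 6 = 2 \<or> d 2 = 2 \<or> d 3 = 2" using wheel[of 2 3] sp unfolding d spindle_def by auto
  show "d 5 = 2 \<or> d 0 = 2 \<or> d 6 = 2 \<or> d 2 = 2 \<or> d 4 = 2" using wheel[of 2 4] sp unfolding d spindle_def by auto
qed

definition red_spindle :: "'a set \<Rightarrow> (nat \<Rightarrow> 'a) \<Rightarrow> bool" where
  "red_spindle L u \<longleftrightarrow> hub (card L) 7 L u \<and> card L + 3 = r \<and> spindle u \<and> red_clique L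
    \<and> (\<forall>i<7. \<forall>l\<in>L. w (u i) l = 2)"

text \<open>Vertex 3 can bear multiplicity 4, because no vertex red to all hubs is red to both ends
  of a red edge at 3: this would complete a red clique of size r. The total 16 is exactly 16 q / 7
  for q = 7.\<close>

lemma no_red_spindle_perfect:
  assumes sp: "red_spindle L u" and perfect: "w (u 3) (u 0) = 2" "w (u 3) (u 4) = 2" "w (u 3) (u 6) = 2"
  shows False
proof -
  define h where "h = card L"
  have hub: "hub h 7 L u" and h: "h + 3 = r" and spin: "spindle u" and red: "red_clique L"
    and uL: "\<And>i l. i < 7 \<Longrightarrow> l \<in> L \<Longrightarrow> w (u i) l = 2"
    using sp unfolding red_spindle_def h_def by auto
  note misses = spindle_misses[OF hub h spin]
  define c where "c i = (if i = 3 then 4 else 2::nat)" for i :: nat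
  have sc: "(\<Sum>i<7. c i) = 16" unfolding sum_less_7 c_def by simp
  show False
  proof (rule hub_contra[OF hub, where q = 7 and d = 0 and c = c])
    fix v assume v: "v \<in> V" and vL: "\<And>l. l \<in> L \<Longrightarrow> w v l = 2"
    then have nz: "\<And>l. l \<in> L \<Longrightarrow> w l v \<noteq> 0" using sym by (metis zero_neq_numeral)
    have nr: "2 - w (u 3) v \<noteq> 0 \<or> 2 - w (u j) v \<noteq> 0" if "w (u 3) (u j) = 2" "j < 7" for j
    proof (rule ccontr)
      assume "\<not> (2 - w (u 3) v \<noteq> 0 \<or> 2 - w (u j) v \<noteq> 0)"
      then have "w (u 3) v = 2" "w (u j) v = 2" using le2[of "u 3" v] le2[of "u j" v] by auto
      then have "card L + 3 < r"
        using red_triangle_card[OF red, of "u 3" "u j" v] uL vL that by simp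
      then show False using h unfolding h_def by simp
    qed
    have "14 \<le> 2 * (2 - w (u 0) v) + 2 * (2 - w (u 1) v) + 2 * (2 - w (u 2) v) + 4 * (2 - w (u 3) v)
        + 2 * (2 - w (u 4) v) + 2 * (2 - w (u 5) v) + 2 * (2 - w (u 6) v)"
      by (rule spindle_deficit_perfect[OF misses[OF nz v] nr nr nr]) (use perfect in auto)
    then show "2 * 7 \<le> (\<Sum>i<7. c i * (2 - w (u i) v))" unfolding sum_less_7 c_def by simp
  next
    fix v assume v: "v \<in> V" and "\<And>l. l \<in> L \<Longrightarrow> w v l \<noteq> 0"
    then have nz: "\<And>l. l \<in> L \<Longrightarrow> w l v \<noteq> 0" using sym by metis
    from spindle_deficit_6[OF misses[OF nz v]]
    show "7 + 0 \<le> (\<Sum>i<7. c i * (2 - w (u i) v))" unfolding sum_less_7 c_def by simp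
  qed (use h sc in auto)
qed

text \<open>All edges between hubs and rim are red, so no discount is available. Multiplicity 4 at
  the apex suffices unless some \<open>v\<close> red to all hubs is also red to the apex, a
  reflected apex and one end of the edge between them. Put in place of the other end, it makes a red
  spindle to which \<open>no_red_spindle_perfect\<close> applies.\<close>

lemma no_red_spindle:
  assumes sp: "red_spindle L u"
  shows False
proof -
  define h where "h = card L"
  have hub: "hub h 7 L u" and h: "h + 3 = r" and spin: "spindle u" and red: "red_clique L"
    and uL: "\<And>i l. i < 7 \<Longrightarrow> l \<in> L \<Longrightarrow> w (u i) l = 2"
    using sp unfolding red_spindle_def h_def by auto
  have uV: "\<And>i. i < 7 \<Longrightarrow> u i \<in> V" using hub unfolding hub_def by blast
  have L: "clique L" using hub unfolding hub_def by blast
  note misses = spindle_misses[OF hub h spin]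
  define c where "c i = (if i = 0 then 4 else 2::nat)" for i :: nat
  have sc: "(\<Sum>i<7. c i) = 16" unfolding sum_less_7 c_def by simp
  show False
  proof (rule hub_contra[OF hub, where q = 7 and d = 0 and c = c])
    fix v assume v: "v \<in> V" and vL: "\<And>l. l \<in> L \<Longrightarrow> w v l = 2"
    then have nz: "\<And>l. l \<in> L \<Longrightarrow> w l v \<noteq> 0" using sym by (metis zero_neq_numeral)
    have new: False if ab: "w (p 0) (p 1) \<noteq> 0" "w (p 0) (p 2) \<noteq> 0" "w (p 1) (p 2) \<noteq> 0" "w (p 5) (p 1) \<noteq> 0" "w (p 5) (p 2) \<noteq> 0"
        "w (p 0) (p 4) \<noteq> 0" "w (p 6) (p 4) \<noteq> 0" "w (p 5) (p 6) \<noteq> 0" "p 3 = v"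
      and red_v: "w v (p 0) = 2" "w v (p 4) = 2" "w v (p 6) = 2"
      and p: "\<And>i. i < 7 \<Longrightarrow> i \<noteq> 3 \<Longrightarrow> p i \<in> u ` {..<7}" for p :: "nat \<Rightarrow> 'a"
    proof -
      have pV: "p i \<in> V \<and> (\<forall>l\<in>L. w (p i) l = 2)" if i: "i < 7" for i
      proof (cases "i = 3")
        case True
        then show ?thesis using ab v vL by simp
      next
        case False
        then obtain j where "j < 7" "p i = u j" using p[OF i] by auto
        then show ?thesis using uV uL by simp
      qed
      have "spindle p"
        unfolding spindle_def using ab red_v sym[of "p 0" v] sym[of "p 6" v] by simp
      then have "red_spindle L p"
        unfolding red_spindle_def hub_def using pV h L red h_def by simp
      then show False
        using no_red_spindle_perfect[of L p] ab red_v by simp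
    qed
    have none: "\<not> (2 - w (u 0) v = 0 \<and> (2 - w (u 4) v = 0 \<and> 2 - w (u 6) v = 0 \<or> 2 - w (u 3) v = 0 \<and> 2 - w (u 6) v = 0
        \<or> 2 - w (u 1) v = 0 \<and> 2 - w (u 5) v = 0 \<or> 2 - w (u 2) v = 0 \<and> 2 - w (u 5) v = 0))"
    proof
      have r: "w v (u i) = 2" if "2 - w (u i) v = 0" for i
        using that le2[of "u i" v] sym[of v "u i"] by simp
      \<comment> \<open>\<open>v\<close> always occupies position 3. If it belongs to the edge {1,
        2}, the two halves of the spindle are interchanged first.\<close>
      define p where "p a a' b' x z i = [u 0, u a, u a', v, u b', u x, u z] ! i" for a a' b' x z i
      have p: "p a a' b' x z 0 = u 0" "p a a' b' x z 1 = u a" "p a a' b' x z 2 = u a'" "p a a' b' x z 3 = v"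
        "p a a' b' x z 4 = u b'" "p a a' b' x z 5 = u x" "p a a' b' x z 6 = u z" for a a' b' x z
        unfolding p_def by (simp_all add: numeral_eq_Suc)
      have im: "p a a' b' x z i \<in> u ` {..<7}"
        if "a < 7" "a' < 7" "b' < 7" "x < 7" "z < 7" "i < 7" "i \<noteq> 3" for a a' b' x z i
      proof -
        have "\<forall>i<7. i \<noteq> 3 \<longrightarrow> p a a' b' x z i \<in> u ` {..<7}"
          unfolding All_less_7 p using that by auto
        then show ?thesis using that by blast
      qed
      note s = spin[unfolded spindle_def]
      have s6: "w (u 6) (u 5) \<noteq> 0" using s sym[of "u 6" "u 5"] by simp
      assume "2 - w (u 0) v = 0 \<and> (2 - w (u 4) v = 0 \<and> 2 - w (u 6) v = 0 \<or> 2 - w (u 3) v = 0 \<and> 2 - w (u 6) v = 0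
        \<or> 2 - w (u 1) v = 0 \<and> 2 - w (u 5) v = 0 \<or> 2 - w (u 2) v = 0 \<and> 2 - w (u 5) v = 0)"
      then show False
      proof (elim conjE disjE)
        assume "2 - w (u 0) v = 0" "2 - w (u 4) v = 0" "2 - w (u 6) v = 0"
        then show False
          by (intro new[of "p 1 2 4 5 6", unfolded p, OF _ _ _ _ _ _ _ _ refl r r r im])
            (use s s6 in \<open>simp_all only:\<close>, simp_all)
      next
        assume "2 - w (u 0) v = 0" "2 - w (u 3) v = 0" "2 - w (u 6) v = 0"
        then show False
          by (intro new[of "p 1 2 3 5 6", unfolded p, OF _ _ _ _ _ _ _ _ refl r r r im])
            (use s s6 in \<open>simp_all only:\<close>, simp_all)
      next
        assume "2 - w (u 0) v = 0" "2 - w (u 1) v = 0" "2 - w (u 5) v = 0"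
        then show False
          by (intro new[of "p 3 4 1 6 5", unfolded p, OF _ _ _ _ _ _ _ _ refl r r r im])
            (use s s6 in \<open>simp_all only:\<close>, simp_all)
      next
        assume "2 - w (u 0) v = 0" "2 - w (u 2) v = 0" "2 - w (u 5) v = 0"
        then show False
          by (intro new[of "p 3 4 2 6 5", unfolded p, OF _ _ _ _ _ _ _ _ refl r r r im])
            (use s s6 in \<open>simp_all only:\<close>, simp_all)
      qed
    qed
    from spindle_deficit_centre[OF misses[OF nz v]]
    have "14 \<le> 4 * (2 - w (u 0) v) + 2 * (2 - w (u 1) v) + 2 * (2 - w (u 2) v) + 2 * (2 - w (u 3) v)
        + 2 * (2 - w (u 4) v) + 2 * (2 - w (u 5) v) + 2 * (2 - w (u 6) v)"
      by (rule disjE) (assumption+, erule notE[OF none])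
    then show "2 * 7 \<le> (\<Sum>i<7. c i * (2 - w (u i) v))"
      unfolding sum_less_7 c_def by simp
  next
    fix v assume v: "v \<in> V" and "\<And>l. l \<in> L \<Longrightarrow> w v l \<noteq> 0"
    then have nz: "\<And>l. l \<in> L \<Longrightarrow> w l v \<noteq> 0" using sym by metis
    from spindle_deficit_6[OF misses[OF nz v]]
    show "7 + 0 \<le> (\<Sum>i<7. c i * (2 - w (u i) v))" unfolding sum_less_7 c_def by simp
  qed (use h sc in auto)
qed

lemma no_spindle_hub:
  assumes hub0: "hub h 7 L0 u0" and h: "h + 3 = r" and spin0: "spindle u0"
  shows False
proof -
  have "\<exists>L u. hub h 7 L u \<and> spindle u \<and> red_clique L"
  proof (rule hub_red_exists[where Q = spindle, OF _ _ hub0 spin0])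
    fix L u v assume "hub h 7 L u" "spindle u" "v \<in> V" "\<And>l. l \<in> L \<Longrightarrow> w l v \<noteq> 0"
    from spindle_deficit_6[OF spindle_misses[OF this(1) h this(2,4,3)]]
    show "6 \<le> (\<Sum>i<7. 2 - w (u i) v)" unfolding sum_less_7 by simp
  qed (use h in simp)
  from hub_red_maximal[OF this] obtain L u where hub: "hub h 7 L u" and spin: "spindle u" and red: "red_clique L"
    and max_hub: "\<forall>l\<in>L. \<forall>i<7. \<forall>v\<in>V. w (u i) l \<noteq> 2 \<longrightarrow> (\<forall>x\<in>L - {l}. w v x = 2)
      \<longrightarrow> (\<exists>i<7. w v (u i) \<noteq> 2)"
    by blast
  have L: "card L = h" using hub unfolding hub_def by auto
  note misses = spindle_misses[OF hub h spin]
  show False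
  proof (cases "\<forall>i<7. \<forall>l\<in>L. w (u i) l = 2")
    case True
    then have "red_spindle L u" using hub h spin red L unfolding red_spindle_def by simp
    then show False by (rule no_red_spindle)
  next
    case False
    then obtain i0 l0 where l0: "i0 < 7" "l0 \<in> L" "w (u i0) l0 \<noteq> 2" by blast
    have mh: "\<exists>i<7. w v (u i) \<noteq> 2" if "v \<in> V" "\<And>x. x \<in> L - {l0} \<Longrightarrow> w v x = 2" for v
      using max_hub l0 that by blast
    \<comment> \<open>The total 17 is one more than 16 q / 7 for q = 7, and the discount d = 1 at
      \<open>l0\<close> pays for it.\<close>
    define c where "c i = (if i \<le> 2 then 3 else 2::nat)" for i :: nat
    have sc: "(\<Sum>i<7. c i) = 17" unfolding sum_less_7 c_def by simp
    have ge: "14 \<le> (\<Sum>i<7. c i * (2 - w (u i) v))" if v: "v \<in> V" and vL: "\<And>l. l \<in> L \<Longrightarrow> w v l \<noteq> 0" for v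
    proof -
      have nz: "\<And>l. l \<in> L \<Longrightarrow> w l v \<noteq> 0" using vL sym by metis
      from spindle_deficit_14[OF misses[OF nz v]]
      show ?thesis unfolding sum_less_7 c_def by simp
    qed
    show False
    proof (rule hub_contra[OF hub, where q = 7 and d = 1 and c = c and ?l0.0 = l0])
      fix v assume "v \<in> V" "\<And>l. l \<in> L \<Longrightarrow> w v l = 2"
      then show "2 * 7 \<le> (\<Sum>i<7. c i * (2 - w (u i) v))" using ge[of v] by simp
    next
      fix v assume "v \<in> V" "\<And>l. l \<in> L \<Longrightarrow> w v l \<noteq> 0"
      then show "7 + 1 \<le> (\<Sum>i<7. c i * (2 - w (u i) v))" using ge[of v] by simp
    next
      show "14 * (7 * h + (\<Sum>i<7. c i)) + 10 * 7 \<le> 14 * 7 * r + 14 * 1" using h sc by simp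
      show "0 < (\<Sum>i<7. c i)" using sc by simp
      show "2 * 1 \<le> c i" for i unfolding c_def by simp
    qed (use l0 mh in auto)
  qed
qed

subsection \<open>Transitivity of the green relation\<close>


lemma edge_card:
  assumes L: "clique L" "\<And>l. l \<in> L \<Longrightarrow> w a l \<noteq> 0" "\<And>l. l \<in> L \<Longrightarrow> w b l \<noteq> 0" and ab: "w a b \<noteq> 0"
  shows "card L + 2 \<le> r"
proof -
  have V: "a \<in> V" "b \<in> V" using supp[of a b] supp[of b a] ab sym[of a b] by auto
  have n: "b \<notin> L" "a \<notin> insert b L" using L(2)[of a] L(3)[of b] ab by auto
  have "clique (insert a (insert b L))"
    using L ab V by (intro clique_insert) auto
  from clique_le[OF this] show ?thesis using n clique_finite[OF L(1)] by simp
qed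

lemma clique_adj: "clique K \<Longrightarrow> x \<in> K \<Longrightarrow> y \<in> K \<Longrightarrow> x \<noteq> y \<Longrightarrow> w x y \<noteq> 0"
  unfolding clique_def by blast

lemma clique_subset: "clique K \<Longrightarrow> K \<subseteq> V"
  unfolding clique_def by blast

text \<open>
  The two cliques of size r - 1 are the unions of L with A and with B; t measures how far they are
  from coinciding.
\<close>
definition linked_cliques :: "nat \<Rightarrow> 'a set \<Rightarrow> 'a set \<Rightarrow> 'a set \<Rightarrow> 'a \<Rightarrow> 'a \<Rightarrow> 'a \<Rightarrow> bool" where
  "linked_cliques t L A B x y z \<longleftrightarrow>
     clique (L \<union> A) \<and> clique (L \<union> B) \<and> L \<inter> A = {} \<and> L \<inter> B = {} \<and>
     card L + t + 1 = r \<and> card A = t \<and> card B = t \<and>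
     (\<forall>l\<in>L \<union> A. w x l \<noteq> 0 \<and> w y l \<noteq> 0) \<and> (\<forall>l\<in>L \<union> B. w y l \<noteq> 0 \<and> w z l \<noteq> 0) \<and>
     (\<forall>l\<in>L. w x l \<noteq> 0 \<and> w y l \<noteq> 0 \<and> w z l \<noteq> 0) \<and> w x z \<noteq> 0"

lemma no_spindle_sets:
  assumes c: "linked_cliques 2 L A B x y z"
  shows False
proof -
  obtain a a' where A: "A = {a, a'}" "a \<noteq> a'" using c card_2_iff unfolding linked_cliques_def by metis
  obtain b b' where B: "B = {b, b'}" "b \<noteq> b'" using c card_2_iff unfolding linked_cliques_def by metis
  define u where "u i = [y, a, a', b, b', x, z] ! i" for i
  have u: "u 0 = y" "u 1 = a" "u 2 = a'" "u 3 = b" "u 4 = b'" "u 5 = x" "u 6 = z"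
    unfolding u_def by (simp_all add: numeral_eq_Suc)
  have LA: "clique (L \<union> A)" "clique (L \<union> B)" "L \<inter> A = {}" "L \<inter> B = {}" "card L + 3 = r"
    using c unfolding linked_cliques_def by simp_all
  have adj: "\<And>l. l \<in> L \<union> A \<Longrightarrow> w x l \<noteq> 0 \<and> w y l \<noteq> 0" "\<And>l. l \<in> L \<union> B \<Longrightarrow> w y l \<noteq> 0 \<and> w z l \<noteq> 0" "w x z \<noteq> 0"
    using c unfolding linked_cliques_def by blast+
  have L: "clique L" using clique_mono[OF LA(1)] by blast
  have e: "w y a \<noteq> 0" "w y a' \<noteq> 0" "w x a \<noteq> 0" "w x a' \<noteq> 0" "w y b \<noteq> 0" "w y b' \<noteq> 0" "w z b \<noteq> 0" "w z b' \<noteq> 0"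
    using adj(1)[of a] adj(1)[of a'] adj(2)[of b] adj(2)[of b'] A B by blast+
  have e2: "w a a' \<noteq> 0" "w b b' \<noteq> 0"
    using clique_adj[OF LA(1), of a a'] clique_adj[OF LA(2), of b b'] A B by simp_all
  have V: "x \<in> V" "y \<in> V" "z \<in> V" "a \<in> V" "a' \<in> V" "b \<in> V" "b' \<in> V"
    using supp[OF e(3)] supp[OF e(1)] supp[OF e(7)] clique_subset[OF LA(1)] clique_subset[OF LA(2)] A(1) B(1)
    by simp_all
  have aL: "w q l \<noteq> 0" if q: "q \<in> {a, a', b, b'}" and l: "l \<in> L" for q l
  proof -
    have "q \<in> A \<or> q \<in> B" "q \<noteq> l" using q l A(1) B(1) LA(3,4) by auto
    then show ?thesis using clique_adj[OF LA(1), of q l] clique_adj[OF LA(2), of q l] l by blast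
  qed
  have "\<forall>i<7. u i \<in> V \<and> (\<forall>l\<in>L. w (u i) l \<noteq> 0)"
    unfolding All_less_7 u using V adj aL by simp
  then have "hub (card L) 7 L u" unfolding hub_def using L by blast
  moreover have "spindle u" unfolding spindle_def u using e e2 adj(3) by blast
  ultimately show False using no_spindle_hub LA(5) by blast
qed

text \<open>For t = 0, \<open>L\<close> with \<open>x\<close> and \<open>z\<close> is a clique of
  size r + 1; for t = 1, \<open>x\<close>, \<open>a\<close>, \<open>y\<close>, \<open>b\<close>,
  \<open>z\<close> is the rim of a wheel; t = 2 is a spindle. For larger t, multiplicity 3 on
  \<open>L\<close> and 1 on all other vertices yields a vertex of deficit below 6. It is green to
  one element of \<open>A\<close> and one of \<open>B\<close> and to nothing else, so it can join
  \<open>L\<close>, and t decreases.\<close>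

lemma no_linked_cliques: "\<not> linked_cliques t L A B x y z"
proof (induction t arbitrary: L A B)
  case 0
  show ?case
  proof
    assume c: "linked_cliques 0 L A B x y z"
    have "clique (L \<union> A)" "card L + 1 = r" using c unfolding linked_cliques_def by simp_all
    moreover have "w x z \<noteq> 0" "\<And>l. l \<in> L \<Longrightarrow> w x l \<noteq> 0" "\<And>l. l \<in> L \<Longrightarrow> w z l \<noteq> 0"
      using c unfolding linked_cliques_def by blast+
    ultimately show False using edge_card[of L x z] clique_mono[of "L \<union> A" L] by simp
  qed
next
  case (Suc t)
  show ?case
  proof
    assume c: "linked_cliques (Suc t) L A B x y z"
    have LA: "clique (L \<union> A)" "clique (L \<union> B)" "L \<inter> A = {}" "L \<inter> B = {}" "card L + Suc t + 1 = r" "card A = Suc t" "card B = Suc t"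
      using c unfolding linked_cliques_def by simp_all
    have adj: "\<And>l. l \<in> L \<union> A \<Longrightarrow> w x l \<noteq> 0 \<and> w y l \<noteq> 0" "\<And>l. l \<in> L \<union> B \<Longrightarrow> w y l \<noteq> 0 \<and> w z l \<noteq> 0" "w x z \<noteq> 0"
      using c unfolding linked_cliques_def by blast+
    have L: "clique L" using clique_mono[OF LA(1)] by blast
    have fin': "finite L" "finite A" "finite B" using LA(1,2) clique_finite by blast+
    consider "t = 0" | "t = 1" | "2 \<le> t" by linarith
    then show False
    proof cases
      case 1
      then obtain a b where ab: "A = {a}" "B = {b}" using LA(6,7) card_1_singletonE by (metis One_nat_def)
      have e: "w x a \<noteq> 0" "w y a \<noteq> 0" "w y b \<noteq> 0" "w z b \<noteq> 0" using adj(1)[of a] adj(2)[of b] ab by auto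
      have abL: "w a l \<noteq> 0 \<and> w b l \<noteq> 0" if l: "l \<in> L" for l
      proof -
        have "a \<noteq> l" "b \<noteq> l" using l ab LA(3,4) by auto
        then show ?thesis using clique_adj[OF LA(1), of a l] clique_adj[OF LA(2), of b l] l ab by simp
      qed
      have e': "w a y \<noteq> 0" "w b z \<noteq> 0" "w z x \<noteq> 0" using e adj(3) sym[of a y] sym[of b z] sym[of z x] by simp_all
      have h: "card L + 2 = r" using LA(5) 1 by simp
      show False
        by (rule no_wheel[OF L h _ e(1) e'(1) e(3) e'(2,3)]) (use adj abL in blast)
    next
      case 2
      then show False using no_spindle_sets[of L A B x y z] c by (simp add: numeral_2_eq_2)
    next
      case 3
      define F where "F v = (\<Sum>l\<in>L. 3 * (2 - w l v)) + (\<Sum>l\<in>A. 1 * (2 - w l v)) + (\<Sum>l\<in>B. 1 * (2 - w l v))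
        + (2 - w x v) + (2 - w y v) + (2 - w z v)" for v
      have "A \<noteq> {}" "B \<noteq> {}" using LA(6,7) by auto
      then obtain a0 b0 where "a0 \<in> A" "b0 \<in> B" by blast
      then have V: "x \<in> V" "y \<in> V" "z \<in> V"
        using adj(1)[of a0] adj(2)[of b0] supp[of x a0] supp[of y a0] supp[of z b0] by simp_all
      have LV: "L \<union> A \<subseteq> V" "L \<union> B \<subseteq> V" using clique_subset LA(1,2) by blast+
      have lF: "light F ((\<Sum>l\<in>L. 3) + (\<Sum>l\<in>A. 1) + (\<Sum>l\<in>B. 1) + 1 + 1 + 1)"
        unfolding F_def using V LV fin' by (intro light_add light_sum light_deficit) auto
      show False
      proof (rule light_contra[OF lF, of 6])
        \<comment> \<open>The total is \<open>3 * r - card A\<close>, and at most 3 r - 3 is needed.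
          Hence \<open>card A\<close> must be at least 3, and the wheel and the spindle require
          arguments of their own.\<close>
        show "14 * ((\<Sum>l\<in>L. 3) + (\<Sum>l\<in>A. 1) + (\<Sum>l\<in>B. 1) + 1 + 1 + 1) + 5 * 6 \<le> 7 * 6 * r"
          using LA 3 by simp
        fix v assume v: "v \<in> V"
        have s0: "w l v = 0 \<longleftrightarrow> w v l = 0" for l using sym by metis
        have one: "2 \<le> (\<Sum>l\<in>S. 1 * (2 - w l v))" if "q \<in> S" "w q v = 0" "finite S" for q S
          using member_le_sum[of q S "\<lambda>l. 1 * (2 - w l v)"] that by simp
        have two: "4 \<le> (\<Sum>l\<in>S. 1 * (2 - w l v))" if "q \<in> S" "w q v = 0" "q' \<in> S" "w q' v = 0" "q' \<noteq> q" "finite S" for q q' S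
          using member_le_sum2[of S q q' "\<lambda>l. 1 * (2 - w l v)"] that by simp
        show "6 \<le> F v"
        proof (cases "\<exists>l\<in>L. w l v = 0")
          case True
          then obtain l where l: "l \<in> L" "w l v = 0" by blast
          then have "6 \<le> (\<Sum>l\<in>L. 3 * (2 - w l v))"
            using member_le_sum[of l L "\<lambda>l. 3 * (2 - w l v)"] fin' by simp
          then show ?thesis unfolding F_def by simp
        next
          case False
          then have vL: "\<And>l. l \<in> L \<Longrightarrow> w v l \<noteq> 0" using s0 by blast
          \<comment> \<open>\<open>L \<union> S\<close> together with \<open>q\<close> is a clique
            of size r, so \<open>v\<close> is green to one of its vertices.\<close>
          have ext: "\<exists>q\<in>S. w q v = 0"
            if S: "clique (L \<union> S)" "card S = Suc t" "L \<inter> S = {}" "finite S" and q: "w q v \<noteq> 0" "\<And>l. l \<in> L \<union> S \<Longrightarrow> w q l \<noteq> 0" for q S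
          proof (rule ccontr)
            assume "\<not> (\<exists>q\<in>S. w q v = 0)"
            then have "card (L \<union> S) + 2 \<le> r"
              using vL s0 q by (intro edge_card[OF S(1), of q v]) auto
            moreover have "card (L \<union> S) = card L + card S" using S fin' by (simp add: card_Un_disjoint)
            ultimately show False using LA(5) S(2) by simp
          qed
          note extA = ext[OF LA(1,6,3) fin'(2)] and extB = ext[OF LA(2,7,4) fin'(3)]
          show ?thesis
          proof (cases "w y v = 0")
            case True
            have "2 \<le> (\<Sum>l\<in>A. 1 * (2 - w l v)) + (2 - w x v)"
            proof (cases "w x v = 0")
              case False
              then obtain q where "q \<in> A" "w q v = 0" using extA[of x] adj by blast
              then show ?thesis using one[of q A] fin' by simp
            qed simp
            moreover have "2 \<le> (\<Sum>l\<in>B. 1 * (2 - w l v)) + (2 - w z v)"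
            proof (cases "w z v = 0")
              case False
              then obtain q where "q \<in> B" "w q v = 0" using extB[of z] adj by blast
              then show ?thesis using one[of q B] fin' by simp
            qed simp
            ultimately show ?thesis using True unfolding F_def by simp
          next
            case False
            obtain a where a: "a \<in> A" "w a v = 0" using extA[of y] adj False by blast
            obtain b where b: "b \<in> B" "w b v = 0" using extB[of y] adj False by blast
            note oA = one[OF a fin'(2)] and oB = one[OF b fin'(3)]
            show ?thesis
            proof (cases "(\<exists>q\<in>A. q \<noteq> a \<and> w q v = 0) \<or> (\<exists>q\<in>B. q \<noteq> b \<and> w q v = 0) \<or> w x v = 0 \<or> w z v = 0")
              case True
              then have "4 \<le> (\<Sum>l\<in>A. 1 * (2 - w l v)) \<or> 4 \<le> (\<Sum>l\<in>B. 1 * (2 - w l v)) \<or> 2 - w x v = 2 \<or> 2 - w z v = 2"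
                using two[OF a _ _ _ fin'(2)] two[OF b _ _ _ fin'(3)] by auto
              then show ?thesis using oA oB unfolding F_def by linarith
            next
              \<comment> \<open>Now \<open>v\<close> is green to \<open>a\<close> and
                \<open>b\<close> only and becomes a common vertex of both cliques in their
                stead.\<close>
              case nomiss: False
              have vAB: "\<And>q. q \<in> A - {a} \<Longrightarrow> w v q \<noteq> 0" "\<And>q. q \<in> B - {b} \<Longrightarrow> w v q \<noteq> 0"
                using nomiss s0 by blast+
              have vn: "v \<notin> L" "v \<notin> A - {a}" "v \<notin> B - {b}" using vL vAB irr by blast+
              have cl: "clique (insert v L \<union> (A - {a}))" "clique (insert v L \<union> (B - {b}))"
                using clique_insert[OF v clique_mono[OF LA(1)], of "L \<union> (A - {a})"]
                  clique_insert[OF v clique_mono[OF LA(2)], of "L \<union> (B - {b})"] vL vAB by auto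
              have "linked_cliques t (insert v L) (A - {a}) (B - {b}) x y z"
                unfolding linked_cliques_def
              proof (intro conjI cl)
                show "card (insert v L) + t + 1 = r" using vn fin' LA(5) by simp
                show "card (A - {a}) = t" "card (B - {b}) = t" using LA(6,7) a b fin' by auto
                show "insert v L \<inter> (A - {a}) = {}" "insert v L \<inter> (B - {b}) = {}" using vn LA(3,4) by auto
              qed (use adj nomiss False in auto)
              then show ?thesis using Suc.IH by blast
            qed
          qed
        qed
      qed simp
    qed
  qed
qed

lemma green_transitive:
  assumes sat: "\<And>x y. x \<in> V \<Longrightarrow> y \<in> V \<Longrightarrow> x \<noteq> y \<Longrightarrow> w x y = 0 \<Longrightarrow>
      \<exists>L. clique L \<and> card L + 1 = r \<and> (\<forall>l\<in>L. w x l \<noteq> 0 \<and> w y l \<noteq> 0)"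
    and V: "x \<in> V" "y \<in> V" "z \<in> V" and g: "w x y = 0" "w y z = 0"
  shows "w x z = 0"
proof (rule ccontr)
  assume xz: "w x z \<noteq> 0"
  have "x \<noteq> y" "y \<noteq> z" using xz g by auto
  then obtain L1 L2 where L1: "clique L1" "card L1 + 1 = r" "\<forall>l\<in>L1. w x l \<noteq> 0 \<and> w y l \<noteq> 0"
    and L2: "clique L2" "card L2 + 1 = r" "\<forall>l\<in>L2. w y l \<noteq> 0 \<and> w z l \<noteq> 0"
    using sat[of x y] sat[of y z] V g by metis
  have f: "finite L1" "finite L2" using L1 L2 clique_finite by blast+
  have c1: "card L1 = card (L1 \<inter> L2) + card (L1 - L2)"
    using card_Int_Diff[OF f(1)] .
  have c2: "card L2 = card (L1 \<inter> L2) + card (L2 - L1)"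
    using card_Int_Diff[OF f(2), of L1] by (simp add: Int_commute)
  have "linked_cliques (card (L1 - L2)) (L1 \<inter> L2) (L1 - L2) (L2 - L1) x y z"
    unfolding linked_cliques_def
  proof (intro conjI)
    show "clique (L1 \<inter> L2 \<union> (L1 - L2))" by (rule clique_mono[OF L1(1)]) blast
    show "clique (L1 \<inter> L2 \<union> (L2 - L1))" by (rule clique_mono[OF L2(1)]) blast
    show "card (L1 \<inter> L2) + card (L1 - L2) + 1 = r" using c1 L1 by simp
    show "card (L2 - L1) = card (L1 - L2)" using c1 c2 L1 L2 by simp
  qed (use L1 L2 xz in auto)
  then show False using no_linked_cliques by blast
qed

text \<open>Take \<open>w'\<close> above \<open>w\<close> of maximal total weight. Raising a green
  pair \<open>x\<close>, \<open>y\<close> to blue preserves the degree condition and creates no red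
  edge, so by maximality it must create a clique of size at least r + 1, which contains
  \<open>x\<close> and \<open>y\<close>. Removing both leaves the common neighbours sought.\<close>

lemma saturate:
  obtains w' where "\<And>x y. w x y \<le> w' x y" "weighted_free V w' r"
    "\<And>x y. x \<in> V \<Longrightarrow> y \<in> V \<Longrightarrow> x \<noteq> y \<Longrightarrow> w' x y = 0 \<Longrightarrow>
      \<exists>L. weighted.clique V w' L \<and> card L + 1 = r \<and> (\<forall>l\<in>L. w' x l \<noteq> 0 \<and> w' y l \<noteq> 0)"
proof -
  define P where "P w' \<longleftrightarrow> weighted_free V w' r \<and> (\<forall>x y. w x y \<le> w' x y)" for w'
  define f where "f w' = (\<Sum>x\<in>V. \<Sum>y\<in>V. w' x y)" for w' :: "'a \<Rightarrow> 'a \<Rightarrow> nat"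
  have "f w' < card V * (card V * 2) + 1" if "P w'" for w'
  proof -
    interpret W: weighted_free V w' r using that unfolding P_def by blast
    have "f w' \<le> (\<Sum>x\<in>V. \<Sum>y\<in>V. 2)" unfolding f_def by (intro sum_mono W.le2)
    then show ?thesis by simp
  qed
  moreover have "P w" unfolding P_def using weighted_free_axioms by simp
  ultimately obtain w' where w': "P w'" and max: "\<And>w''. P w'' \<Longrightarrow> f w'' \<le> f w'"
    using Lattices_Big.ex_has_greatest_nat[of P w f "card V * (card V * 2) + 1"] by blast
  interpret W: weighted_free V w' r using w' unfolding P_def by blast
  show thesis
  proof (rule that[of w'])
    show "w x y \<le> w' x y" for x y using w' unfolding P_def by blast
    show "weighted_free V w' r" by (rule W.weighted_free_axioms)
    fix x y assume xy: "x \<in> V" "y \<in> V" "x \<noteq> y" "w' x y = 0"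
    define w2 where "w2 a b = (if {a, b} = {x, y} then 1 else w' a b)" for a b
    have xy': "w' y x = 0" using xy W.sym by metis
    have ge: "w' a b \<le> w2 a b" for a b
      unfolding w2_def using xy xy' by (auto simp: doubleton_eq_iff)
    interpret W2: weighted V w2 r
    proof
      show "finite V" by (rule fin)
      show "w2 a b = w2 b a" for a b unfolding w2_def using W.sym[of a b] by (simp add: insert_commute)
      show "w2 a a = 0" for a unfolding w2_def using xy by (auto simp: doubleton_eq_iff)
      show "w2 a b \<le> 2" for a b unfolding w2_def using W.le2 by simp
      show "a \<in> V" if "w2 a b \<noteq> 0" for a b
        using that xy W.supp unfolding w2_def by (auto simp: doubleton_eq_iff split: if_splits)
      show "3 \<le> r" by (rule r3)
      fix v assume v: "v \<in> V"
      have "(\<Sum>u\<in>V. 2 - w2 v u) \<le> (\<Sum>u\<in>V. 2 - w' v u)"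
        using ge by (intro sum_mono diff_le_mono2)
      then have "int (\<Sum>u\<in>V. 2 - w2 v u) \<le> int (\<Sum>u\<in>V. 2 - w' v u)" by (simp only: of_nat_le_iff)
      then have "(7 * int r - 5) * int (\<Sum>u\<in>V. 2 - w2 v u) \<le> (7 * int r - 5) * int (\<Sum>u\<in>V. 2 - w' v u)"
        using r3 by (intro mult_left_mono) auto
      then show "(7 * int r - 5) * int (\<Sum>u\<in>V. 2 - w2 v u) < 14 * int (card V)"
        using W.deg[OF v] by linarith
    qed
    have "f w' < f w2"
      unfolding f_def
    proof (rule sum_strict_mono_ex1[OF fin])
      show "\<forall>a\<in>V. (\<Sum>b\<in>V. w' a b) \<le> (\<Sum>b\<in>V. w2 a b)" using ge by (auto intro: sum_mono)
      have "(\<Sum>b\<in>V. w' x b) < (\<Sum>b\<in>V. w2 x b)"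
        by (rule sum_strict_mono_ex1[OF fin]) (use ge xy in \<open>auto simp: w2_def intro!: bexI[of _ y]\<close>)
      then show "\<exists>a\<in>V. (\<Sum>b\<in>V. w' a b) < (\<Sum>b\<in>V. w2 a b)" using xy by blast
    qed
    then have "\<not> P w2" using max[of w2] by auto
    moreover have "w a b \<le> w2 a b" for a b using ge[of a b] w' unfolding P_def by (meson le_trans)
    ultimately have nf: "\<not> weighted_free V w2 r" unfolding P_def by blast
    have red: "card K < r" if "W2.red_clique K" for K
    proof (rule W.red_clique_less)
      show "W.red_clique K"
        unfolding W.red_clique_def
      proof (intro conjI ballI impI)
        show "K \<subseteq> V" using that unfolding W2.red_clique_def by blast
        fix a b assume "a \<in> K" "b \<in> K" "a \<noteq> b"
        then have "w2 a b = 2" using that unfolding W2.red_clique_def by blast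
        then show "w' a b = 2" unfolding w2_def by (auto split: if_splits)
      qed
    qed
    have "\<exists>K. W2.clique K \<and> \<not> card K \<le> r"
    proof (rule ccontr)
      assume "\<not> ?thesis"
      then have "weighted_free V w2 r" by unfold_locales (use red in blast)+
      then show False using nf by blast
    qed
    then obtain K where K: "W2.clique K" "r < card K" by auto
    have KV: "K \<subseteq> V" and Kadj: "\<And>a b. a \<in> K \<Longrightarrow> b \<in> K \<Longrightarrow> a \<noteq> b \<Longrightarrow> w2 a b \<noteq> 0"
      using K(1) unfolding W2.clique_def by blast+
    have inK: "x \<in> K" "y \<in> K"
    proof -
      have "x \<in> K \<and> y \<in> K"
      proof (rule ccontr)
        assume n: "\<not> (x \<in> K \<and> y \<in> K)"
        have "W.clique K"
          unfolding W.clique_def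
        proof (intro conjI ballI impI KV)
          fix a b assume ab: "a \<in> K" "b \<in> K" "a \<noteq> b"
          then have "{a, b} \<noteq> {x, y}" using n by (auto simp: doubleton_eq_iff)
          then show "w' a b \<noteq> 0" using Kadj[OF ab] unfolding w2_def by simp
        qed
        then show False using W.clique_le K(2) by fastforce
      qed
      then show "x \<in> K" "y \<in> K" by auto
    qed
    have finK: "finite K" using KV fin finite_subset by blast
    have "card (K - {x, y}) = card K - 2" using inK xy(3) finK by (simp add: card_Diff_subset)
    then have "r - 1 \<le> card (K - {x, y})" using K(2) by simp
    then obtain L where L: "L \<subseteq> K - {x, y}" "card L = r - 1"
      using obtain_subset_with_card_n by metis
    have "W.clique L"
      unfolding W.clique_def
    proof (intro conjI ballI impI)
      show "L \<subseteq> V" using L KV by blast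
      fix a b assume ab: "a \<in> L" "b \<in> L" "a \<noteq> b"
      then have "{a, b} \<noteq> {x, y}" "w2 a b \<noteq> 0" using L Kadj by blast+
      then show "w' a b \<noteq> 0" unfolding w2_def by simp
    qed
    moreover have "w' x l \<noteq> 0 \<and> w' y l \<noteq> 0" if "l \<in> L" for l
    proof -
      have "w2 x l \<noteq> 0" "w2 y l \<noteq> 0" using that L inK Kadj by blast+
      moreover have "{x, l} \<noteq> {x, y}" "{y, l} \<noteq> {x, y}" using that L by auto
      ultimately show ?thesis unfolding w2_def by simp
    qed
    ultimately show "\<exists>L. W.clique L \<and> card L + 1 = r \<and> (\<forall>l\<in>L. w' x l \<noteq> 0 \<and> w' y l \<noteq> 0)"
      using L(2) r3 by auto
  qed
qed

end

subsection \<open>Red cliques across the green classes\<close>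

locale multipartite = weighted_free +
  assumes green_trans: "x \<in> V \<Longrightarrow> y \<in> V \<Longrightarrow> z \<in> V \<Longrightarrow> w x y = 0 \<Longrightarrow> w y z = 0 \<Longrightarrow> w x z = 0"
begin

definition cls :: "'a \<Rightarrow> 'a set" where
  "cls x = {y \<in> V. w x y = 0}"

lemma cls_eq: "x \<in> V \<Longrightarrow> y \<in> V \<Longrightarrow> cls x = cls y \<longleftrightarrow> w x y = 0"
proof
  assume "x \<in> V" "y \<in> V" "cls x = cls y"
  moreover have "y \<in> cls y" using \<open>y \<in> V\<close> unfolding cls_def by simp
  ultimately show "w x y = 0" unfolding cls_def by blast
next
  assume xy: "x \<in> V" "y \<in> V" "w x y = 0"
  then have yx: "w y x = 0" using sym[of x y] by simp
  show "cls x = cls y"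
    unfolding cls_def
  proof (rule Collect_cong, rule iffI)
    fix z assume "z \<in> V \<and> w x z = 0"
    then show "z \<in> V \<and> w y z = 0" using green_trans[OF xy(2,1) _ yx] by blast
  next
    fix z assume "z \<in> V \<and> w y z = 0"
    then show "z \<in> V \<and> w x z = 0" using green_trans[OF xy(1,2) _ xy(3)] by blast
  qed
qed

lemma mem_cls: "c \<in> cls ` V \<Longrightarrow> z \<in> c \<longleftrightarrow> z \<in> V \<and> cls z = c"
proof -
  assume "c \<in> cls ` V"
  then obtain x where x: "x \<in> V" "c = cls x" by blast
  show ?thesis using cls_eq[OF x(1), of z] unfolding x(2) cls_def[of x] by auto
qed

lemma finite_cls: "c \<in> cls ` V \<Longrightarrow> finite c"
  using fin unfolding cls_def by auto

lemma card_classes_le: "card (cls ` V) \<le> r"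
proof -
  obtain K where K: "K \<subseteq> V" "inj_on cls K" "cls ` V = cls ` K"
    using subset_image_inj[of "cls ` V" cls V] by auto
  have "clique K"
    unfolding clique_def
  proof (intro conjI ballI impI)
    fix x y assume xy: "x \<in> K" "y \<in> K" "x \<noteq> y"
    then have "cls x \<noteq> cls y" using K(2) by (meson inj_onD)
    then show "w x y \<noteq> 0" using cls_eq[of x y] xy K(1) by blast
  qed (rule K(1))
  then show ?thesis using clique_le[of K] card_image[OF K(2)] K(3) by simp
qed

lemma red_clique_inj: "red_clique Q \<Longrightarrow> inj_on cls Q"
proof
  fix x y assume Q: "red_clique Q" and xy: "x \<in> Q" "y \<in> Q" "cls x = cls y"
  then have "w x y = 0" using cls_eq[of x y] unfolding red_clique_def by blast
  then show "x = y" using Q xy unfolding red_clique_def by fastforce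
qed

text \<open>
  In these units V has size 7 r - 5 and every class has size below 7; the slacks of r classes sum to 10.
\<close>
definition unit :: real where
  "unit = card V / (7 * r - 5)"

definition nonred :: "'a \<Rightarrow> 'a set \<Rightarrow> nat" where
  "nonred x c = (\<Sum>z\<in>c. if w x z = 2 then 0 else 1)"

definition slack :: "'a set \<Rightarrow> real" where
  "slack c = 14 * unit - 2 * card c"

lemma unit_eq: "(7 * real r - 5) * unit = card V"
  using r3 unfolding unit_def by (simp add: of_nat_diff)

lemma sum_classes: "(\<Sum>x\<in>V. h x) = (\<Sum>c\<in>cls ` V. \<Sum>x\<in>c. h x)" for h :: "'a \<Rightarrow> nat"
proof -
  have "(\<Sum>c\<in>cls ` V. \<Sum>x\<in>c. h x) = (\<Sum>c\<in>cls ` V. \<Sum>x\<in>{x \<in> V. cls x = c}. h x)"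
    using mem_cls by (intro sum.cong refl) auto
  also have "\<dots> = (\<Sum>x\<in>V. h x)" using fin by (intro sum.group) auto
  finally show ?thesis by simp
qed

text \<open>The deficit of \<open>x\<close> is below 14 units. Its own class takes twice its size,
  and every vertex elsewhere that is not red to \<open>x\<close> takes at least 1, whichever classes
  in \<open>D\<close> it lies in.\<close>

lemma nonred_less_slack:
  assumes x: "x \<in> V" and D: "D \<subseteq> cls ` V" "cls x \<notin> D"
  shows "(\<Sum>c\<in>D. real (nonred x c)) < slack (cls x)"
proof -
  have finD: "finite D" using D fin finite_subset by blast
  have "(\<Sum>c\<in>D. nonred x c) + 2 * card (cls x) \<le> (\<Sum>c\<in>D. \<Sum>u\<in>c. 2 - w x u) + (\<Sum>u\<in>cls x. 2 - w x u)"
  proof (rule add_mono)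
    show "(\<Sum>c\<in>D. nonred x c) \<le> (\<Sum>c\<in>D. \<Sum>u\<in>c. 2 - w x u)"
      unfolding nonred_def
    proof (intro sum_mono)
      fix c u show "(if w x u = 2 then 0 else 1) \<le> 2 - w x u" using le2[of x u] by auto
    qed
    have "(\<Sum>u\<in>cls x. 2 - w x u) = (\<Sum>u\<in>cls x. 2)"
      unfolding cls_def by (intro sum.cong) auto
    then show "2 * card (cls x) \<le> (\<Sum>u\<in>cls x. 2 - w x u)" by simp
  qed
  also have "\<dots> = (\<Sum>c\<in>insert (cls x) D. \<Sum>u\<in>c. 2 - w x u)" using finD D(2) by simp
  also have "\<dots> \<le> (\<Sum>c\<in>cls ` V. \<Sum>u\<in>c. 2 - w x u)"
    using D x fin by (intro sum_mono2) auto
  also have "\<dots> = (\<Sum>u\<in>V. 2 - w x u)" by (rule sum_classes[symmetric])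
  finally have le: "(\<Sum>c\<in>D. nonred x c) + 2 * card (cls x) \<le> (\<Sum>u\<in>V. 2 - w x u)" .
  have "real_of_int ((7 * int r - 5) * int (\<Sum>u\<in>V. 2 - w x u)) < real_of_int (14 * int (card V))"
    using deg[OF x] by (simp only: of_int_less_iff)
  then have "(7 * real r - 5) * real (\<Sum>u\<in>V. 2 - w x u) < (7 * real r - 5) * (14 * unit)"
    using unit_eq by (simp add: algebra_simps)
  then have "real (\<Sum>u\<in>V. 2 - w x u) < 14 * unit"
    using r3 by (simp add: mult_less_cancel_left)
  moreover have "real ((\<Sum>c\<in>D. nonred x c) + 2 * card (cls x)) \<le> real (\<Sum>u\<in>V. 2 - w x u)"
    using le by (simp only: of_nat_le_iff)
  ultimately show ?thesis unfolding slack_def by simp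
qed

lemma slack_pos: "c \<in> cls ` V \<Longrightarrow> 0 < slack c"
  using nonred_less_slack[of _ "{}"] by auto

text \<open>A union bound for a class that contains no vertex red to all of \<open>Q\<close>, so
  that \<open>Q\<close> cannot be extended into it directly.\<close>

lemma card_le_sum_nonred:
  assumes "finite Q" "finite c" "\<And>z. z \<in> c \<Longrightarrow> \<exists>q\<in>Q. w q z \<noteq> 2"
  shows "real (card c) \<le> (\<Sum>q\<in>Q. real (nonred q c))"
proof -
  have "card c = (\<Sum>z\<in>c. 1)" by simp
  also have "\<dots> \<le> (\<Sum>z\<in>c. \<Sum>q\<in>Q. if w q z = 2 then 0 else 1)"
  proof (rule sum_mono)
    fix z assume "z \<in> c"
    then obtain q where "q \<in> Q" "w q z \<noteq> 2" using assms(3) by blast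
    then show "1 \<le> (\<Sum>q\<in>Q. if w q z = 2 then 0 else 1 :: nat)"
      using member_le_sum[of q Q "\<lambda>q. if w q z = 2 then 0 else 1 :: nat"] assms(1) by simp
  qed
  also have "\<dots> = (\<Sum>q\<in>Q. nonred q c)" unfolding nonred_def by (rule sum.swap)
  finally have "real (card c) \<le> real (\<Sum>q\<in>Q. nonred q c)" by (simp only: of_nat_le_iff)
  then show ?thesis by simp
qed

section \<open>Exactly r green classes\<close>

context
  assumes card_classes: "card (cls ` V) = r"
begin

lemma unit_pos: "0 < unit"
proof -
  have "V \<noteq> {}" using card_classes r3 by auto
  then have "0 < real (card V)" using fin by (simp add: card_gt_0_iff)
  then show ?thesis using r3 unfolding unit_def by simp
qed

lemma sum_slack: "(\<Sum>c\<in>cls ` V. slack c) = 10 * unit"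
proof -
  have "card V = (\<Sum>x\<in>V. 1)" by simp
  also have "\<dots> = (\<Sum>c\<in>cls ` V. card c)" unfolding sum_classes by simp
  finally have "real (card V) = (\<Sum>c\<in>cls ` V. real (card c))" by simp
  then have "(\<Sum>c\<in>cls ` V. slack c) = real r * (14 * unit) - 2 * real (card V)"
    unfolding slack_def sum_subtractf using card_classes by (simp add: sum_distrib_left)
  then show ?thesis unfolding unit_eq[symmetric] by (simp add: algebra_simps)
qed

lemma sum_slack_le: "S \<subseteq> cls ` V \<Longrightarrow> (\<Sum>c\<in>S. slack c) \<le> 10 * unit"
  unfolding sum_slack[symmetric] using fin slack_pos by (intro sum_mono2) (auto intro: less_imp_le)

text \<open>If neither adding a vertex of \<open>l\<close> nor one exchange inside \<open>Q\<close>
  works, two classes are covered by non-red neighbourhoods of cliques sharing all but one vertex.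
  The sizes of the two classes are then below the total slack of 10 units, against
  \<open>big\<close>.\<close>

lemma red_clique_extend:
  assumes Q: "red_clique Q" and l: "l \<in> cls ` V" "l \<notin> cls ` Q"
    and big: "\<And>i. i \<in> cls ` Q \<Longrightarrow> 10 * unit \<le> real (card i) + real (card l)"
  shows "\<exists>Q'. red_clique Q' \<and> cls ` Q' = insert l (cls ` Q)"
proof (cases "\<exists>z\<in>l. \<forall>q\<in>Q. w z q = 2")
  case True
  then obtain z where z: "z \<in> l" "\<And>q. q \<in> Q \<Longrightarrow> w z q = 2" by blast
  have zV: "z \<in> V" "cls z = l" using z mem_cls[OF l(1)] by auto
  then have "red_clique (insert z Q)" using red_clique_insert Q z by blast
  then show ?thesis using zV by blast
next
  case False
  have QV: "Q \<subseteq> V" using Q unfolding red_clique_def by blast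
  have finQ: "finite Q" using QV fin finite_subset by blast
  have inj: "inj_on cls Q" by (rule red_clique_inj[OF Q])
  have cover: "\<exists>q\<in>Q. w q z \<noteq> 2" if "z \<in> l" for z using False that sym by metis
  have finl: "finite l" by (rule finite_cls[OF l(1)])
  \<comment> \<open>Some z in l fails to be red to just one p in Q. Replacing p by z leaves the class of p to be
    covered, and both failures together would exceed the total slack.\<close>
  have "\<exists>z\<in>l. (\<Sum>q\<in>Q. if w q z = 2 then 0 else 1 :: nat) < 2"
  proof (rule ccontr)
    assume "\<not> ?thesis"
    then have "(\<Sum>z\<in>l. 2) \<le> (\<Sum>z\<in>l. \<Sum>q\<in>Q. if w q z = 2 then 0 else 1 :: nat)"
      by (intro sum_mono) (simp add: not_less)
    also have "\<dots> = (\<Sum>q\<in>Q. nonred q l)" unfolding nonred_def by (rule sum.swap)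
    finally have "2 * card l \<le> (\<Sum>q\<in>Q. nonred q l)" by simp
    then have "real (2 * card l) \<le> real (\<Sum>q\<in>Q. nonred q l)" by (simp only: of_nat_le_iff)
    also have "\<dots> = (\<Sum>q\<in>Q. real (nonred q l))" by simp
    also have "\<dots> \<le> (\<Sum>q\<in>Q. slack (cls q))"
    proof (rule sum_mono)
      fix q assume "q \<in> Q"
      then have "q \<in> V" "cls q \<noteq> l" using QV l(2) by blast+
      then show "real (nonred q l) \<le> slack (cls q)"
        using nonred_less_slack[of q "{l}"] l(1) by simp
    qed
    also have "\<dots> = (\<Sum>c\<in>cls ` Q. slack c)" using inj by (simp add: sum.reindex)
    \<comment> \<open>This is \<open>2 * card l - 4 * unit\<close>, less than the left-hand side of
      the chain.\<close>
    also have "\<dots> \<le> 10 * unit - slack l"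
      using sum_slack_le[of "insert l (cls ` Q)"] l QV finQ by (simp add: image_mono)
    finally show False using unit_pos unfolding slack_def by simp
  qed
  then obtain z where z: "z \<in> l" "(\<Sum>q\<in>Q. if w q z = 2 then 0 else 1 :: nat) < 2" by blast
  obtain p where p: "p \<in> Q" "w p z \<noteq> 2" using cover z by blast
  have pz: "w z q = 2" if "q \<in> Q - {p}" for q
  proof (rule ccontr)
    assume "w z q \<noteq> 2"
    then have "w q z \<noteq> 2" using sym[of z q] by simp
    moreover have "p \<noteq> q" "q \<in> Q" using that by auto
    ultimately show False
      using member_le_sum2[of Q p q "\<lambda>q. if w q z = 2 then 0 else 1 :: nat"] p z(2) finQ by simp
  qed
  have zV: "z \<in> V" "cls z = l" using z mem_cls[OF l(1)] by auto
  define Q0 where "Q0 = Q - {p}"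
  have Q0: "Q = insert p Q0" "p \<notin> Q0" "finite Q0" "Q0 \<subseteq> V" "Q0 \<subseteq> Q"
    unfolding Q0_def using p finQ QV by auto
  have redz: "red_clique (insert z Q0)"
    using red_clique_insert[OF zV(1) red_clique_mono[OF Q]] pz unfolding Q0_def by blast
  define i where "i = cls p"
  have pV: "p \<in> V" using p QV by blast
  have i: "i \<in> cls ` V" "i \<in> cls ` Q" unfolding i_def using p pV by auto
  have i0: "i \<notin> cls ` Q0" 
  proof
    assume "i \<in> cls ` Q0"
    then obtain q where "q \<in> Q0" "cls q = cls p" unfolding i_def by auto
    then show False using inj_onD[OF inj, of q p] Q0(2,5) p(1) by auto
  qed
  have l0: "l \<notin> cls ` Q0" "l \<noteq> i" using l(2) Q0(5) i(2) by blast+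
  have zQ0: "z \<notin> Q0" using l0(1) zV by blast
  show ?thesis
  proof (cases "\<exists>z'\<in>i. \<forall>q\<in>insert z Q0. w z' q = 2")
    case True
    then obtain z' where z': "z' \<in> i" "\<And>q. q \<in> insert z Q0 \<Longrightarrow> w z' q = 2" by blast
    have z'V: "z' \<in> V" "cls z' = i" using z' mem_cls[OF i(1)] by auto
    then have "red_clique (insert z' (insert z Q0))" using red_clique_insert redz z' by blast
    moreover have "cls ` insert z' (insert z Q0) = insert l (cls ` Q)"
      unfolding Q0(1) image_insert z'V zV i_def by blast
    ultimately show ?thesis by blast
  next
    case False
    then have cover': "\<exists>q\<in>insert z Q0. w q z' \<noteq> 2" if "z' \<in> i" for z' using that sym by metis
    have "real (card i) \<le> (\<Sum>q\<in>insert z Q0. real (nonred q i))"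
      using Q0(3) finite_cls[OF i(1)] cover' by (intro card_le_sum_nonred) auto
    then have 1: "real (card i) \<le> real (nonred z i) + (\<Sum>q\<in>Q0. real (nonred q i))"
      using zQ0 Q0(3) by simp
    have "real (card l) \<le> (\<Sum>q\<in>Q. real (nonred q l))"
      using finQ finl cover by (intro card_le_sum_nonred) auto
    then have 2: "real (card l) \<le> real (nonred p l) + (\<Sum>q\<in>Q0. real (nonred q l))"
      unfolding Q0(1) using Q0(2,3) by simp
    have 3: "real (nonred z i) < slack l" "real (nonred p l) < slack i"
      using nonred_less_slack[of z "{i}"] nonred_less_slack[of p "{l}"] zV pV i l(1) l0(2) unfolding i_def by auto
    \<comment> \<open>Each \<open>q\<close> pays for both classes out of one slack, so every class
      is charged at most once in the total.\<close>
    have "(\<Sum>q\<in>Q0. real (nonred q i) + real (nonred q l)) \<le> (\<Sum>q\<in>Q0. slack (cls q))"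
    proof (rule sum_mono)
      fix q assume q: "q \<in> Q0"
      then have "cls q \<noteq> i" "cls q \<noteq> l" "q \<in> V" using i0 l0 Q0(4) by blast+
      then show "real (nonred q i) + real (nonred q l) \<le> slack (cls q)"
        using nonred_less_slack[of q "{i, l}"] i l l0(2) by auto
    qed
    also have "\<dots> = (\<Sum>c\<in>cls ` Q0. slack c)"
      using inj_on_subset[OF inj Q0(5)] by (simp add: sum.reindex)
    finally have "real (card i) + real (card l) < (\<Sum>c\<in>cls ` Q0. slack c) + slack l + slack i"
      using 1 2 3 by (simp add: sum.distrib)
    also have "\<dots> = (\<Sum>c\<in>insert l (insert i (cls ` Q0)). slack c)"
      using l0 i0 Q0(3) by simp
    also have "\<dots> \<le> 10 * unit" using l i Q0(4) by (intro sum_slack_le) auto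
    finally show ?thesis using big[OF i(2)] by simp
  qed
qed

lemma red_clique_grow:
  assumes Q: "red_clique Q" and T: "finite T" "T \<subseteq> cls ` V" "T \<inter> cls ` Q = {}"
    and big: "\<And>i l. l \<in> T \<Longrightarrow> i \<in> cls ` Q \<union> T \<Longrightarrow> i \<noteq> l \<Longrightarrow> 10 * unit \<le> real (card i) + real (card l)"
  shows "\<exists>Q'. red_clique Q' \<and> cls ` Q' = cls ` Q \<union> T"
  using T big
proof (induction T)
  case empty
  then show ?case using Q by auto
next
  case (insert l T)
  obtain Q' where Q': "red_clique Q'" "cls ` Q' = cls ` Q \<union> T" using insert by auto
  have "\<exists>Q''. red_clique Q'' \<and> cls ` Q'' = insert l (cls ` Q')"
  proof (rule red_clique_extend[OF Q'(1)])
    show "l \<in> cls ` V" "l \<notin> cls ` Q'" using insert.prems insert.hyps Q'(2) by auto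
    fix i assume "i \<in> cls ` Q'"
    then show "10 * unit \<le> real (card i) + real (card l)"
      using insert.prems(3)[of l i] insert.prems(2) insert.hyps Q'(2) by auto
  qed
  then show ?case using Q'(2) by auto
qed

text \<open>Growth of a red clique needs class sizes summing to at least 10 units, and only pairs
  involving a newly added class matter. Hence a class of at most 4 units is left to the end, while
  if there is none, the initial red edge is placed in a pair of small sum, if such a pair
  exists.\<close>

lemma red_free_pair:
  "\<exists>i\<in>cls ` V. \<exists>j\<in>cls ` V. i \<noteq> j \<and> (\<forall>x\<in>i. \<forall>y\<in>j. w x y \<noteq> 2)"
proof (rule ccontr)
  assume none: "\<not> ?thesis"
  have edge: "\<exists>Q. red_clique Q \<and> cls ` Q = {i, j}" if ij: "i \<in> cls ` V" "j \<in> cls ` V" "i \<noteq> j" for i j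
  proof -
    obtain x y where xy: "x \<in> i" "y \<in> j" "w x y = 2" using none ij by blast
    have V: "x \<in> V" "cls x = i" "y \<in> V" "cls y = j" using xy mem_cls ij by auto
    have "red_clique {x, y}" using V xy sym[of x y] unfolding red_clique_def by auto
    then show ?thesis using V by (intro exI[of _ "{x, y}"]) auto
  qed
  have finC: "finite (cls ` V)" using fin by simp
  have full: False if "red_clique Q" "cls ` Q = cls ` V" for Q
    using red_clique_less[OF that(1)] card_image[OF red_clique_inj[OF that(1)]] that(2) card_classes by simp
  have pair: "\<exists>i j. i \<in> S \<and> j \<in> S \<and> i \<noteq> j" if "2 \<le> card S" for S :: "'a set set"
    using that card_le_Suc0_iff_eq[of S] card.infinite[of S] by (metis not_less_eq_eq numeral_2_eq_2 zero_le)
  have three: "slack a + slack b + slack c \<le> 10 * unit"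
    if "a \<in> cls ` V" "b \<in> cls ` V" "c \<in> cls ` V" "a \<noteq> b" "a \<noteq> c" "b \<noteq> c" for a b c
    using sum_slack_le[of "{a, b, c}"] that by simp
  show False
  proof (cases "\<exists>c\<in>cls ` V. real (card c) \<le> 4 * unit")
    case True
    then obtain c where c: "c \<in> cls ` V" "real (card c) \<le> 4 * unit" by blast
    have "2 \<le> card (cls ` V - {c})" using c card_classes r3 by simp
    then obtain i j where ij: "i \<in> cls ` V - {c}" "j \<in> cls ` V - {c}" "i \<noteq> j" using pair by blast
    then obtain Q0 where Q0: "red_clique Q0" "cls ` Q0 = {i, j}" using edge[of i j] by auto
    have "\<exists>Q. red_clique Q \<and> cls ` Q = cls ` Q0 \<union> (cls ` V - {c, i, j})"
    proof (rule red_clique_grow[OF Q0(1)])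
      fix k l assume kl: "l \<in> cls ` V - {c, i, j}" "k \<in> cls ` Q0 \<union> (cls ` V - {c, i, j})" "k \<noteq> l"
      then have k: "k \<in> cls ` V" "k \<noteq> c" using Q0 ij by auto
      \<comment> \<open>\<open>slack c\<close> is at least 6 units, so the slacks of
        \<open>k\<close> and \<open>l\<close> sum to at most 4, and their sizes to at least
        12.\<close>
      show "10 * unit \<le> real (card k) + real (card l)"
        using three[of k l c] kl k c unit_pos unfolding slack_def by simp
    qed (use finC Q0 in auto)
    moreover have "cls ` Q0 \<union> (cls ` V - {c, i, j}) = cls ` V - {c}" using Q0 ij by auto
    ultimately obtain Q where Q: "red_clique Q" "cls ` Q = cls ` V - {c}" by auto
    have QV: "Q \<subseteq> V" using Q unfolding red_clique_def by blast
    have finQ: "finite Q" using QV fin finite_subset by blast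
    have Qne: "Q \<noteq> {}" using Q(2) ij by auto
    show False
    proof (cases "\<exists>z\<in>c. \<forall>q\<in>Q. w z q = 2")
      case True
      then obtain z where z: "z \<in> c" "\<And>q. q \<in> Q \<Longrightarrow> w z q = 2" by blast
      have zV: "z \<in> V" "cls z = c" using z mem_cls[OF c(1)] by auto
      then have "red_clique (insert z Q)" using red_clique_insert Q z by blast
      moreover have "cls ` insert z Q = cls ` V" using zV Q(2) c(1) by auto
      ultimately show False by (rule full)
    next
      case False
      then have "\<exists>q\<in>Q. w q z \<noteq> 2" if "z \<in> c" for z using that sym by metis
      then have "real (card c) \<le> (\<Sum>q\<in>Q. real (nonred q c))"
        using finQ finite_cls[OF c(1)] by (intro card_le_sum_nonred) auto
      also have "\<dots> < (\<Sum>q\<in>Q. slack (cls q))"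
      proof (rule sum_strict_mono[OF finQ Qne])
        fix q assume "q \<in> Q"
        then have "q \<in> V" "cls q \<noteq> c" using QV Q(2) by blast+
        then show "real (nonred q c) < slack (cls q)" using nonred_less_slack[of q "{c}"] c(1) by auto
      qed
      also have "\<dots> = (\<Sum>c\<in>cls ` Q. slack c)" using red_clique_inj[OF Q(1)] by (simp add: sum.reindex)
      also have "\<dots> = 10 * unit - slack c"
        unfolding Q(2) sum_slack[symmetric] using finC c(1) by (simp add: sum_diff1)
      \<comment> \<open>The right-hand side is \<open>2 * card c - 4 * unit\<close>, which is at
        most \<open>card c\<close> for a class of at most 4 units.\<close>
      finally show False using c(2) unfolding slack_def by simp
    qed
  next
    case False
    then have s4: "4 * unit < real (card c)" if "c \<in> cls ` V" for c using that by force
    have "\<exists>i j. i \<in> cls ` V \<and> j \<in> cls ` V \<and> i \<noteq> j \<and>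
        (\<forall>l\<in>cls ` V - {i, j}. \<forall>k\<in>cls ` V. k \<noteq> l \<longrightarrow> 10 * unit \<le> real (card k) + real (card l))"
    proof (cases "\<exists>i\<in>cls ` V. \<exists>j\<in>cls ` V. i \<noteq> j \<and> real (card i) + real (card j) < 10 * unit")
      case True
      then obtain i j where ij: "i \<in> cls ` V" "j \<in> cls ` V" "i \<noteq> j" "real (card i) + real (card j) < 10 * unit"
        by blast
      \<comment> \<open>The slacks of \<open>i\<close> and \<open>j\<close> sum to more than 8
        units, so \<open>l\<close> has slack below 2 and size above 6; \<open>k\<close> has size
        above 4.\<close>
      have big: "10 * unit \<le> real (card k) + real (card l)" if "l \<in> cls ` V - {i, j}" "k \<in> cls ` V" for k l
      proof -
        have "i \<noteq> l" "j \<noteq> l" using that by auto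
        then show ?thesis using three[of i j l] s4[of k] ij that unfolding slack_def by simp
      qed
      show ?thesis by (intro exI[of _ i] exI[of _ j] conjI ballI impI ij(1,2,3) big)
    next
      case False
      have "2 \<le> card (cls ` V)" using card_classes r3 by simp
      then obtain i j where ij: "i \<in> cls ` V" "j \<in> cls ` V" "i \<noteq> j" using pair by blast
      have big: "10 * unit \<le> real (card k) + real (card l)"
        if "l \<in> cls ` V - {i, j}" "k \<in> cls ` V" "k \<noteq> l" for k l
      proof (rule ccontr)
        assume "\<not> ?thesis"
        then have "real (card k) + real (card l) < 10 * unit" by simp
        then show False using False that(1,2,3) by blast
      qed
      show ?thesis by (intro exI[of _ i] exI[of _ j] conjI ballI impI ij big)
    qed
    then obtain i j where ij: "i \<in> cls ` V" "j \<in> cls ` V" "i \<noteq> j"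
      and big: "\<forall>l\<in>cls ` V - {i, j}. \<forall>k\<in>cls ` V. k \<noteq> l \<longrightarrow> 10 * unit \<le> real (card k) + real (card l)"
      by blast
    obtain Q0 where Q0: "red_clique Q0" "cls ` Q0 = {i, j}" using edge[OF ij] by blast
    have "\<exists>Q. red_clique Q \<and> cls ` Q = cls ` Q0 \<union> (cls ` V - {i, j})"
    proof (rule red_clique_grow[OF Q0(1)])
      fix k l assume kl: "l \<in> cls ` V - {i, j}" "k \<in> cls ` Q0 \<union> (cls ` V - {i, j})" "k \<noteq> l"
      have "k \<in> cls ` V" using kl(2) Q0(2) ij by auto
      then show "10 * unit \<le> real (card k) + real (card l)" by (rule big[rule_format, OF kl(1) _ kl(3)])
    qed (use finC Q0 in auto)
    moreover have "cls ` Q0 \<union> (cls ` V - {i, j}) = cls ` V" using Q0(2) ij by auto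
    ultimately obtain Q where "red_clique Q" "cls ` Q = cls ` V" by auto
    then show False by (rule full)
  qed
qed

end

lemma colouring:
  "\<exists>\<phi>. \<forall>x\<in>V. \<phi> x < r \<and> (\<forall>y\<in>V. (\<phi> x = \<phi> y \<longrightarrow> w x y = 0) \<and> (\<phi> x = 0 \<and> \<phi> y = (1::nat) \<longrightarrow> w x y \<noteq> 2))"
proof (cases "card (cls ` V) < r")
  case True
  obtain g where g: "bij_betw g (cls ` V) {0..<card (cls ` V)}"
    using ex_bij_betw_finite_nat[of "cls ` V"] fin by auto
  have "Suc (g (cls x)) < r" if "x \<in> V" for x
    using bij_betwE[OF g] that True by fastforce
  moreover have "w x y = 0" if "x \<in> V" "y \<in> V" "g (cls x) = g (cls y)" for x y
    using that cls_eq[of x y] g by (metis bij_betw_imp_inj_on image_eqI inj_onD)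
  ultimately show ?thesis by (intro exI[of _ "\<lambda>x. Suc (g (cls x))"]) auto
next
  case False
  then have c: "card (cls ` V) = r" using card_classes_le by simp
  obtain i j where ij: "i \<in> cls ` V" "j \<in> cls ` V" "i \<noteq> j" "\<forall>x\<in>i. \<forall>y\<in>j. w x y \<noteq> 2"
    using red_free_pair[OF c] by blast
  have "card (cls ` V - {i, j}) = r - 2" using ij c by (simp add: card_Diff_subset)
  then obtain g where g: "bij_betw g (cls ` V - {i, j}) {2..<r}"
    using finite_same_card_bij[of "cls ` V - {i, j}" "{2..<r}"] fin by auto
  define f where "f k = (if k = i then 0 else if k = j then 1 else g k)" for k
  have g2: "2 \<le> g k \<and> g k < r" if "k \<in> cls ` V" "k \<noteq> i" "k \<noteq> j" for k
    using bij_betwE[OF g] that by auto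
  have inj: "k = l" if "k \<in> cls ` V" "l \<in> cls ` V" "f k = f l" for k l
  proof (cases "k \<in> {i, j} \<or> l \<in> {i, j}")
    case True
    then show ?thesis using that g2[of k] g2[of l] ij(3) unfolding f_def by (auto split: if_splits)
  next
    case False
    then show ?thesis using that inj_onD[OF bij_betw_imp_inj_on[OF g], of k l] unfolding f_def by auto
  qed
  show ?thesis
  proof (intro exI[of _ "\<lambda>x. f (cls x)"] ballI conjI impI)
    fix x assume x: "x \<in> V"
    show "f (cls x) < r" using g2[of "cls x"] x r3 unfolding f_def by auto
    fix y assume y: "y \<in> V"
    show "w x y = 0" if "f (cls x) = f (cls y)" using inj[of "cls x" "cls y"] that x y cls_eq[OF x y] by blast
    show "w x y \<noteq> 2" if "f (cls x) = 0 \<and> f (cls y) = 1"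
    proof -
      have "cls x = i" "cls y = j"
        using that g2[of "cls x"] g2[of "cls y"] x y unfolding f_def by (auto split: if_splits)
      then show ?thesis using ij x y mem_cls by blast
    qed
  qed
qed

end

subsection \<open>The forbidden family\<close>

text \<open>Lowering weights to 2 inside \<open>B\<close> and 1 elsewhere on \<open>K\<close> leaves
  a copy of the graph; the bijection has to map \<open>B\<close> onto the initial segment, where the
  red clique of \<open>G_graph\<close> sits.\<close>

lemma G_graph_embeds:
  assumes G: "coloured_graph G" and K: "K \<subseteq> verts G" "B \<subseteq> K"
    and nongreen: "\<And>x y. x \<in> K \<Longrightarrow> y \<in> K \<Longrightarrow> x \<noteq> y \<Longrightarrow> weight G x y \<noteq> 0"
    and red: "\<And>x y. x \<in> B \<Longrightarrow> y \<in> B \<Longrightarrow> x \<noteq> y \<Longrightarrow> weight G x y = 2"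
    and card: "card B = b" "card K = t - b"
  shows "\<not> graph_free (G_graph t b) G"
proof -
  have finK: "finite K" using G K(1) finite_subset unfolding coloured_graph_def by blast
  have finB: "finite B" using finK K(2) finite_subset by blast
  have bt: "b \<le> t - b" using card card_mono[OF finK K(2)] by simp
  obtain f where f: "bij_betw f B {..<b}"
    using finite_same_card_bij[OF finB, of "{..<b}"] card by auto
  have "card (K - B) = card {b..<t - b}" using card card_Diff_subset[OF finB K(2)] by simp
  then obtain g where g: "bij_betw g (K - B) {b..<t - b}"
    using finite_same_card_bij[of "K - B" "{b..<t - b}"] finK by blast
  define \<phi> where "\<phi> x = (if x \<in> B then f x else g x)" for x
  have "bij_betw \<phi> B {..<b}" using f by (subst bij_betw_cong[of B \<phi> f]) (auto simp: \<phi>_def)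
  moreover have "bij_betw \<phi> (K - B) {b..<t - b}"
    using g by (subst bij_betw_cong[of "K - B" \<phi> g]) (auto simp: \<phi>_def)
  ultimately have "bij_betw \<phi> (B \<union> (K - B)) ({..<b} \<union> {b..<t - b})"
    by (intro bij_betw_combine) auto
  moreover have "B \<union> (K - B) = K" "{..<b} \<union> {b..<t - b} = {..<t - b}" using K(2) bt by auto
  ultimately have \<phi>: "bij_betw \<phi> K {..<t - b}" by simp
  have \<phi>B: "\<phi> x < b \<longleftrightarrow> x \<in> B" if "x \<in> K" for x
    using that bij_betwE[OF f] bij_betwE[OF g] unfolding \<phi>_def by (cases "x \<in> B") force+
  define H where "H = (K, \<lambda>x y. if x = y then 0 else if x \<in> B \<and> y \<in> B then 2 else 1 :: nat)"
  have "isomorphic H (G_graph t b)"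
    unfolding isomorphic_def
  proof (intro exI[of _ \<phi>] conjI ballI)
    show "bij_betw \<phi> (verts H) (verts (G_graph t b))" using \<phi> unfolding H_def G_graph_def by simp
    fix x y assume "x \<in> verts H" "y \<in> verts H"
    then have xy: "x \<in> K" "y \<in> K" unfolding H_def by auto
    have "\<phi> x = \<phi> y \<longleftrightarrow> x = y" using bij_betw_imp_inj_on[OF \<phi>] xy by (meson inj_onD)
    then show "weight H x y = weight (G_graph t b) (\<phi> x) (\<phi> y)"
      using \<phi>B xy unfolding H_def G_graph_def by simp
  qed
  moreover have "subgraph H G"
    unfolding subgraph_def
  proof (intro conjI G ballI)
    show "coloured_graph H" unfolding coloured_graph_def H_def using finK by auto
    show "verts H \<subseteq> verts G" unfolding H_def using K by simp
    fix x y assume "x \<in> verts H" "y \<in> verts H"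
    then have "x \<in> K" "y \<in> K" unfolding H_def by auto
    then show "weight H x y \<le> weight G x y"
      using nongreen[of x y] red[of x y] unfolding H_def by auto
  qed
  ultimately show ?thesis unfolding graph_free_def by blast
qed

text \<open>Otherwise \<open>B\<close> and \<open>K\<close> can be trimmed to sizes b and 2 r - b,
  the parameters of a member of the family. Capping b at r meets the condition i \<le> t / 2 and
  keeps b \<le> 2 r - b.\<close>

lemma family_free_card:
  assumes G: "coloured_graph G" and free: "family_free (F_family (2 * r)) G"
    and K: "K \<subseteq> verts G" "B \<subseteq> K" "B \<noteq> {}"
    and nongreen: "\<And>x y. x \<in> K \<Longrightarrow> y \<in> K \<Longrightarrow> x \<noteq> y \<Longrightarrow> weight G x y \<noteq> 0"
    and red: "\<And>x y. x \<in> B \<Longrightarrow> y \<in> B \<Longrightarrow> x \<noteq> y \<Longrightarrow> weight G x y = 2"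
    and r: "1 \<le> r"
  shows "card K + card B < 2 * r"
proof (rule ccontr)
  assume "\<not> card K + card B < 2 * r"
  then have ge: "2 * r \<le> card K + card B" by simp
  have finK: "finite K" using G K(1) finite_subset unfolding coloured_graph_def by blast
  have finB: "finite B" using finK K(2) finite_subset by blast
  have BK: "card B \<le> card K" using card_mono[OF finK K(2)] .
  define b where "b = min (card B) r"
  have b: "1 \<le> b" "b \<le> r" "b \<le> card B" "2 * r - b \<le> card K" "b \<le> 2 * r - b"
    using K(3) finB r ge BK unfolding b_def by (auto simp: card_gt_0_iff Suc_le_eq)
  obtain B' where B': "B' \<subseteq> B" "card B' = b" using obtain_subset_with_card_n[OF b(3)] by metis
  obtain K' where K': "B' \<subseteq> K'" "K' \<subseteq> K" "card K' = 2 * r - b"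
    using exists_subset_between[of B' "2 * r - b" K] B' K(2) b finK by auto
  have "\<not> graph_free (G_graph (2 * r) b) G"
  proof (rule G_graph_embeds[OF G, of K' B'])
    show "K' \<subseteq> verts G" using K' K by blast
    show "weight G x y \<noteq> 0" if "x \<in> K'" "y \<in> K'" "x \<noteq> y" for x y using nongreen that K'(2) by blast
    show "weight G x y = 2" if "x \<in> B'" "y \<in> B'" "x \<noteq> y" for x y using red that B'(1) by blast
  qed (use B' K' in auto)
  moreover have "G_graph (2 * r) b \<in> F_family (2 * r)" unfolding F_family_def using b by auto
  ultimately show False using free unfolding family_free_def by blast
qed

theorem theorem1p8:
  fixes r n :: nat and G :: "'a cgraph"
  assumes "r \<ge> 3"
    and "coloured_graph G"
    and "order G = n"
    and "n \<ge> 1"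
    and "family_free (F_family (2 * r)) G"
    and "real (min_degree G) > (14 * real r - 24) / (7 * real r - 5) * real n"
  shows "(\<exists>\<phi>. homomorphism G (RK_minus r) \<phi>) \<and>
    (\<exists>W :: nat \<Rightarrow> 'a set.
       verts G = (\<Union>i\<in>{1..r}. W i) \<and>
       disjoint_family_on W {1..r} \<and>
       (\<forall>i\<in>{1..r}. \<forall>x\<in>W i. \<forall>y\<in>W i. x \<noteq> y \<longrightarrow> green_edge G x y) \<and>
       (\<forall>x\<in>W 1. \<forall>y\<in>W 2. \<not> red_edge G x y))"
proof -
  define V where "V = verts G"
  \<comment> \<open>The weight of \<open>G\<close> is arbitrary outside its vertices, whereas the
    locale needs it to vanish there.\<close>
  define w where "w x y = (if x \<in> V \<and> y \<in> V then weight G x y else 0)" for x y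
  have G: "finite V" "\<And>x y. x \<in> V \<Longrightarrow> y \<in> V \<Longrightarrow> weight G x y \<in> {0, 1, 2}"
    "\<And>x y. x \<in> V \<Longrightarrow> y \<in> V \<Longrightarrow> weight G x y = weight G y x" "\<And>x. x \<in> V \<Longrightarrow> weight G x x = 0"
    using assms(2) unfolding coloured_graph_def V_def by blast+
  have wle: "w x y \<le> 2" for x y using G(2)[of x y] unfolding w_def by auto
  have wsym: "w x y = w y x" for x y using G(3)[of x y] unfolding w_def by auto
  have n: "card V = n" using assms(3) unfolding order_def V_def .
  interpret W0: weighted V w r
  proof
    fix v assume v: "v \<in> V"
    have "vdegree G v = (\<Sum>u\<in>V. w v u)"
      unfolding vdegree_def V_def[symmetric] w_def using v by simp
    moreover have "min_degree G \<le> vdegree G v"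
      unfolding min_degree_def using G(1) v by (intro Min_le) (auto simp: V_def)
    ultimately have "(14 * real r - 24) / (7 * real r - 5) * real n < real (\<Sum>u\<in>V. w v u)"
      using assms(6) by linarith
    then have 1: "(14 * real r - 24) * real n < (7 * real r - 5) * real (\<Sum>u\<in>V. w v u)"
      using assms(1) by (simp add: field_simps)
    have "(\<Sum>u\<in>V. 2 - w v u) + (\<Sum>u\<in>V. w v u) = (\<Sum>u\<in>V. 2)"
      unfolding sum.distrib[symmetric] using wle by (intro sum.cong) auto
    then have "real ((\<Sum>u\<in>V. 2 - w v u) + (\<Sum>u\<in>V. w v u)) = real (2 * n)" using n by simp
    then have 2: "real (\<Sum>u\<in>V. 2 - w v u) = 2 * real n - real (\<Sum>u\<in>V. w v u)"
      by (simp only: of_nat_add of_nat_mult)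
    have "(7 * real r - 5) * real (\<Sum>u\<in>V. 2 - w v u) < 14 * real n"
      unfolding 2 using 1 by (simp add: algebra_simps)
    then have "real_of_int ((7 * int r - 5) * int (\<Sum>u\<in>V. 2 - w v u)) < real_of_int (14 * int (card V))"
      using n by simp
    then show "(7 * int r - 5) * int (\<Sum>u\<in>V. 2 - w v u) < 14 * int (card V)"
      by (simp only: of_int_less_iff)
  next
    fix x y assume "w x y \<noteq> 0" then show "x \<in> V" unfolding w_def by (auto split: if_splits)
  qed (use G(1) wsym wle assms(1) G(4) in \<open>auto simp: w_def\<close>)
  have free: "card K + card B < 2 * r"
    if K: "W0.clique K" "B \<subseteq> K" "B \<noteq> {}" "W0.red_clique B" for K B
  proof (rule family_free_card[OF assms(2,5) _ K(2,3)])
    have "K \<subseteq> V" using K(1) unfolding W0.clique_def by blast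
    then show "K \<subseteq> verts G" unfolding V_def .
    show "weight G x y \<noteq> 0" if "x \<in> K" "y \<in> K" "x \<noteq> y" for x y
    proof -
      have "w x y \<noteq> 0" using K(1) that unfolding W0.clique_def by blast
      then show ?thesis unfolding w_def by (auto split: if_splits)
    qed
    show "weight G x y = 2" if "x \<in> B" "y \<in> B" "x \<noteq> y" for x y
    proof -
      have "w x y = 2" using K(4) that unfolding W0.red_clique_def by blast
      then show ?thesis unfolding w_def by (auto split: if_splits)
    qed
  qed (use assms(1) in simp)
  interpret W1: weighted_free V w r
  proof
    fix K assume K: "W0.clique K"
    show "card K \<le> r" by (rule W0.no_large_clique[OF _ K]) (rule free)
  next
    fix K assume "W0.red_clique K"
    then show "card K < r"
      using free[of K K] W0.red_clique_clique[of K] assms(1) by (cases "K = {}") auto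
  qed
  obtain w' where w': "\<And>x y. w x y \<le> w' x y" "weighted_free V w' r"
    and sat: "\<And>x y. x \<in> V \<Longrightarrow> y \<in> V \<Longrightarrow> x \<noteq> y \<Longrightarrow> w' x y = 0 \<Longrightarrow>
      \<exists>L. weighted.clique V w' L \<and> card L + 1 = r \<and> (\<forall>l\<in>L. w' x l \<noteq> 0 \<and> w' y l \<noteq> 0)"
    using W1.saturate by blast
  interpret W2: weighted_free V w' r by (rule w'(2))
  interpret W3: multipartite V w' r
    by unfold_locales (rule W2.green_transitive[OF sat])
  obtain \<phi> where \<phi>: "\<And>x. x \<in> V \<Longrightarrow> \<phi> x < r"
    "\<And>x y. x \<in> V \<Longrightarrow> y \<in> V \<Longrightarrow> \<phi> x = \<phi> y \<Longrightarrow> w' x y = 0"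
    "\<And>x y. x \<in> V \<Longrightarrow> y \<in> V \<Longrightarrow> \<phi> x = 0 \<Longrightarrow> \<phi> y = (1::nat) \<Longrightarrow> w' x y \<noteq> 2"
    using W3.colouring by metis
  have wG: "weight G x y = w x y" if "x \<in> V" "y \<in> V" for x y using that unfolding w_def by simp
  have same: "weight G x y = 0" if "x \<in> V" "y \<in> V" "\<phi> x = \<phi> y" for x y
    using \<phi>(2)[OF that] w'(1)[of x y] wG that by simp
  have blue: "weight G x y \<le> 1" if "x \<in> V" "y \<in> V" "\<phi> x = 0" "\<phi> y = 1" for x y
    using \<phi>(3)[OF that] w'(1)[of x y] W2.le2[of x y] wG that by simp
  have hom: "homomorphism G (RK_minus r) \<phi>"
    unfolding homomorphism_def
  proof (intro conjI ballI impI)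
    show "\<phi> ` verts G \<subseteq> verts (RK_minus r)" using \<phi>(1) unfolding RK_minus_def RK_def V_def by auto
    fix x y assume "x \<in> verts G" "y \<in> verts G" "x \<noteq> y"
    then have xy: "x \<in> V" "y \<in> V" unfolding V_def by auto
    have le: "weight G x y \<le> 2" using wG[OF xy] wle by simp
    show "weight G x y \<le> weight (RK_minus r) (\<phi> x) (\<phi> y)"
      using same[OF xy] blue[OF xy] blue[OF xy(2,1)] G(3)[OF xy] le
      unfolding RK_minus_def RK_def by (auto simp: doubleton_eq_iff)
  qed
  \<comment> \<open>Colours 0, ..., r - 1 become indices 1, ..., r, so the pair of colours 0 and 1
    corresponds to \<open>W 1\<close> and \<open>W 2\<close>.\<close>
  define W where "W i = {x \<in> V. \<phi> x + 1 = i}" for i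
  have un: "verts G = (\<Union>i\<in>{1..r}. W i)"
    unfolding W_def V_def[symmetric] using \<phi>(1) by force
  have dis: "disjoint_family_on W {1..r}" unfolding disjoint_family_on_def W_def by auto
  have gr: "green_edge G x y" if "x \<in> W i" "y \<in> W i" "x \<noteq> y" for i x y
    using that same[of x y] unfolding green_edge_def W_def V_def by simp
  have re: "\<not> red_edge G x y" if "x \<in> W 1" "y \<in> W 2" for x y
    using that blue[of x y] unfolding red_edge_def W_def by simp
  show ?thesis
    by (intro conjI exI[of _ \<phi>] exI[of _ W] hom un dis ballI impI gr re)
qed

end
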